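(* Let $N\ge1$, $p\in(1,\infty)$, and let $\Omega\subseteq\mathbb{R}^N$ be a bounded domain. Let $\varphi,\psi:[0,\infty)\to[0,\infty)$ be convex $\Phi$-functions such that $\varphi(t)=t^p\ln(e+t)$ for all $t\ge0$, and such that $\lim_{t\to0^+}\frac{\psi(t)}{t^p}$ exists in $\mathbb{R}$ and $\lim_{t\to\infty}\frac{\psi(t)}{\varphi(t)}=0$. Then: (i) the embedding $X_{L_{\Delta_p}}(\Omega)\hookrightarrow L^\varphi(\Omega)$ is continuous; (ii) the embedding $X_{L_{\Delta_p}}(\Omega)\hookrightarrow L^\psi(\Omega)$ is compact.
   Context: Functions on $\Omega$ are extended by $0$ to $\mathbb{R}^N$. With $C_{N,p}:=\frac{p\,\Gamma(N/2)}{2\pi^{N/2}}$ and $[u]_{X_{L_{\Delta_p}}(\Omega)}^p:=C_{N,p}\iint_{x,y\in\mathbb{R}^N,\,|x-y|\le 1}\frac{|u(x)-u(y)|^p}{|x-y|^N}\,dx\,dy$, $X_{L_{\Delta_p}}(\Omega):=\{u\in L^p(\Omega): [u]_{X_{L_{\Delta_p}}(\Omega)}<\infty,\ u=0\text{ in }\mathbb{R}^N\setminus\Omega\}$, normed by $\|u\|_{X_{L_{\Delta_p}}(\Omega)}=(\|u\|_{L^p(\Omega)}^p+[u]_{X_{L_{\Delta_p}}(\Omega)}^p)^{1/p}$. A function $\vartheta:[0,\infty)\to[0,\infty]$ is a $\Phi$-function if it is increasing, $\vartheta(0)=0$, $\lim_{t\to0^+}\vartheta(t)=0$ and $\lim_{t\to\infty}\vartheta(t)=\infty$;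 it is a convex $\Phi$-function if moreover it is left-continuous and convex. For a convex $\Phi$-function $\vartheta$, let $\varrho_\vartheta(u):=\int_\Omega\vartheta(|u|)\,dx$ for measurable $u:\Omega\to\mathbb{R}$; the Orlicz space is $L^\vartheta(\Omega):=\{u \text{ measurable}:\varrho_\vartheta(\lambda u)<\infty\text{ for some }\lambda>0\}$ with the Luxemburg norm $\|u\|_\vartheta:=\inf\{\lambda>0:\varrho_\vartheta(u/\lambda)\le1\}$. *)

theory Defs
  imports "HOL-Analysis.Analysis"
begin

text \<open>
  Functions on \<open>\<Omega>\<close> are represented throughout by their extension by zero to the whole space.
  As usual, functions that agree almost everywhere are not distinguished; the norms below are
  therefore only seminorms on these sets of functions.
\<close>

definition bounded_domain :: "(real ^ 'n) set \<Rightarrow> bool" where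
  "bounded_domain \<Omega> \<longleftrightarrow> open \<Omega> \<and> connected \<Omega> \<and> \<Omega> \<noteq> {} \<and> bounded \<Omega>"

definition C_Np :: "nat \<Rightarrow> real \<Rightarrow> real" where
  "C_Np N p = p * Gamma (real N / 2) / (2 * pi powr (real N / 2))"

definition Lp_modular :: "real \<Rightarrow> (real ^ 'n) set \<Rightarrow> (real ^ 'n \<Rightarrow> real) \<Rightarrow> ennreal" where
  "Lp_modular p \<Omega> u = (\<integral>\<^sup>+ x. ennreal (\<bar>u x\<bar> powr p) \<partial>lebesgue_on \<Omega>)"

text \<open>The \<open>p\<close>-th power of the seminorm of the space \<open>X\<close>, possibly infinite. On the diagonal the
  integrand is \<open>0 / 0 = 0\<close>, which is irrelevant since the diagonal is a null set.\<close>

definition X_energy :: "real \<Rightarrow> (real ^ 'n \<Rightarrow> real) \<Rightarrow> ennreal" where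
  "X_energy p u =
     ennreal (C_Np CARD('n) p) *
     (\<integral>\<^sup>+ z \<in> {(x, y). norm (x - y) \<le> 1}.
        (case z of (x, y) \<Rightarrow> ennreal (\<bar>u x - u y\<bar> powr p / norm (x - y) ^ CARD('n)))
      \<partial>(lebesgue \<Otimes>\<^sub>M lebesgue))"

definition X_space :: "real \<Rightarrow> (real ^ 'n) set \<Rightarrow> (real ^ 'n \<Rightarrow> real) set" where
  "X_space p \<Omega> = {u. u \<in> borel_measurable (lebesgue_on \<Omega>) \<and> Lp_modular p \<Omega> u < \<infinity> \<and>
                      X_energy p u < \<infinity> \<and> (\<forall>x. x \<notin> \<Omega> \<longrightarrow> u x = 0)}"

definition X_norm :: "real \<Rightarrow> (real ^ 'n) set \<Rightarrow> (real ^ 'n \<Rightarrow> real) \<Rightarrow> real" where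
  "X_norm p \<Omega> u = (enn2real (Lp_modular p \<Omega> u) + enn2real (X_energy p u)) powr (1 / p)"

text \<open>Functions \<open>[0,\<infinity>) \<rightarrow> [0,\<infinity>]\<close> are total functions on the reals whose values at negative
  arguments play no role. ``Increasing'' is meant in the weak sense.\<close>

definition Phi_function :: "(real \<Rightarrow> ennreal) \<Rightarrow> bool" where
  "Phi_function \<theta> \<longleftrightarrow>
     mono_on {0..} \<theta> \<and> \<theta> 0 = 0 \<and> (\<theta> \<longlongrightarrow> 0) (at_right 0) \<and> (\<theta> \<longlongrightarrow> \<infinity>) at_top"

definition convex_Phi_function :: "(real \<Rightarrow> ennreal) \<Rightarrow> bool" where
  "convex_Phi_function \<theta> \<longleftrightarrow>
     Phi_function \<theta> \<and>
     (\<forall>t>0. continuous (at_left t) \<theta>) \<and>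
     (\<forall>s\<ge>0. \<forall>t\<ge>0. \<forall>a\<in>{0..1}.
        \<theta> (a * s + (1 - a) * t) \<le> ennreal a * \<theta> s + ennreal (1 - a) * \<theta> t)"

definition Orlicz_modular ::
    "(real \<Rightarrow> ennreal) \<Rightarrow> (real ^ 'n) set \<Rightarrow> (real ^ 'n \<Rightarrow> real) \<Rightarrow> ennreal" where
  "Orlicz_modular \<theta> \<Omega> u = (\<integral>\<^sup>+ x. \<theta> \<bar>u x\<bar> \<partial>lebesgue_on \<Omega>)"

definition Orlicz_space ::
    "(real \<Rightarrow> ennreal) \<Rightarrow> (real ^ 'n) set \<Rightarrow> (real ^ 'n \<Rightarrow> real) set" where
  "Orlicz_space \<theta> \<Omega> = {u. u \<in> borel_measurable (lebesgue_on \<Omega>) \<and>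
                           (\<exists>c>0. Orlicz_modular \<theta> \<Omega> (\<lambda>x. c * u x) < \<infinity>) \<and>
                           (\<forall>x. x \<notin> \<Omega> \<longrightarrow> u x = 0)}"

definition Luxemburg_norm ::
    "(real \<Rightarrow> ennreal) \<Rightarrow> (real ^ 'n) set \<Rightarrow> (real ^ 'n \<Rightarrow> real) \<Rightarrow> real" where
  "Luxemburg_norm \<theta> \<Omega> u = Inf {c. c > 0 \<and> Orlicz_modular \<theta> \<Omega> (\<lambda>x. u x / c) \<le> 1}"

definition continuous_embedding ::
    "('a \<Rightarrow> real) set \<Rightarrow> (('a \<Rightarrow> real) \<Rightarrow> real) \<Rightarrow>
     ('a \<Rightarrow> real) set \<Rightarrow> (('a \<Rightarrow> real) \<Rightarrow> real) \<Rightarrow> bool" where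
  "continuous_embedding X nX Y nY \<longleftrightarrow> X \<subseteq> Y \<and> (\<exists>C. \<forall>u\<in>X. nY u \<le> C * nX u)"

definition compact_embedding ::
    "('a \<Rightarrow> real) set \<Rightarrow> (('a \<Rightarrow> real) \<Rightarrow> real) \<Rightarrow>
     ('a \<Rightarrow> real) set \<Rightarrow> (('a \<Rightarrow> real) \<Rightarrow> real) \<Rightarrow> bool" where
  "compact_embedding X nX Y nY \<longleftrightarrow>
     continuous_embedding X nX Y nY \<and>
     (\<forall>u :: nat \<Rightarrow> 'a \<Rightarrow> real. (\<forall>k. u k \<in> X) \<and> (\<exists>M. \<forall>k. nX (u k) \<le> M) \<longrightarrow>
        (\<exists>v\<in>Y. \<exists>r. strict_mono r \<and> (\<lambda>k. nY (\<lambda>x. u (r k) x - v x)) \<longlonglongrightarrow> 0))"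

end

theory Submission
  imports Defs "HOL-Complex_Analysis.Great_Picard"
begin

text \<open>
  Both parts rest on the bound \<open>\<Sum>\<^sub>k\<^sub><\<^sub>m 2\<^sup>k\<^sup>N 1\<^bsub>|x - y| \<le> 2\<^sup>-\<^sup>k\<^esub> \<le> 2 |x - y|\<^sup>-\<^sup>N\<close>, which lets the energy
  dominate the sum of its contributions from all dyadic scales.

  For the continuous embedding, fix a point \<open>x\<close> and put \<open>t = |u x| / 2\<close>. By Markov's inequality the set
  \<open>{|u| > t}\<close> has measure at most \<open>\<parallel>u\<parallel>\<^sub>p\<^sup>p / t\<^sup>p\<close>, so it fills at most half of every ball around \<open>x\<close>
  of radius \<open>2\<^sup>-\<^sup>k\<close> with \<open>k \<le> m\<close>, where \<open>m\<close> is comparable to \<open>ln t\<close>. Off that set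
  \<open>|u x - u y| \<ge> t\<close>, hence the inner energy integral at \<open>x\<close> is at least a constant times
  \<open>t\<^sup>p ln t\<close>; integrating over \<open>x\<close> bounds the modular of \<open>t\<^sup>p ln (e + t)\<close>.

  For compactness, divide space into cubes of side comparable to \<open>2\<^sup>-\<^sup>j\<close>. The mean oscillation of \<open>u\<close>
  on the cubes of scale \<open>j\<close> is summable over \<open>j\<close> and, up to a constant, decreasing in \<open>j\<close>, so at scale \<open>m\<close>
  it is of order \<open>1/m\<close> times the energy. Bounded sets are thus uniformly approximated in
  \<open>L\<^sup>p\<close> by step functions, and a diagonal argument gives an \<open>L\<^sup>p\<close>-convergent subsequence. Finally
  \<open>\<psi>(t) \<le> \<epsilon> t\<^sup>p ln (e + t) + C t\<^sup>p\<close> upgrades the convergence to \<open>L\<^sup>\<psi>\<close>.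
\<close>

section \<open>The energy and its dyadic scales\<close>

text \<open>The energy lives on a product of two completed measures, and Tonelli's theorem there
  asks for sigma-finiteness. A countable cover by sets of finite \<open>lborel\<close> measure
  serves for the completion too.\<close>

lemma sigma_finite_lebesgue: "sigma_finite_measure (lebesgue :: 'a::euclidean_space measure)"
proof
  obtain A :: "'a set set" where A: "countable A" "A \<subseteq> sets lborel" "\<Union>A = space lborel"
    "\<forall>a\<in>A. emeasure lborel a \<noteq> \<infinity>"
    using lborel.sigma_finite_countable by metis
  then show "\<exists>A::'a set set. countable A \<and> A \<subseteq> sets lebesgue \<and> \<Union>A = space lebesgue \<and>
      (\<forall>a\<in>A. emeasure lebesgue a \<noteq> \<infinity>)"
    by (intro exI[of _ A]) auto
qed

interpretation lebesgue: sigma_finite_measure "lebesgue :: 'a::euclidean_space measure"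
  by (rule sigma_finite_lebesgue)

interpretation lebesgue_pair:
  pair_sigma_finite "lebesgue :: 'a::euclidean_space measure" "lebesgue :: 'b::euclidean_space measure"
  ..

lemma borel_measurable_lebesgue_ident [measurable]:
  "(\<lambda>x. x) \<in> lebesgue \<rightarrow>\<^sub>M (borel :: 'a::euclidean_space measure)"
  by (intro measurable_completion) simp

lemma measurable_dist_lebesgue_pair [measurable]:
  "(\<lambda>z::'a::euclidean_space \<times> 'a. dist (fst z) (snd z)) \<in> borel_measurable (lebesgue \<Otimes>\<^sub>M lebesgue)"
proof -
  have [measurable]: "fst \<in> borel_measurable (lebesgue \<Otimes>\<^sub>M (lebesgue :: 'a measure))"
    "snd \<in> borel_measurable ((lebesgue :: 'a measure) \<Otimes>\<^sub>M lebesgue)"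
    using measurable_compose[OF measurable_fst borel_measurable_lebesgue_ident]
      measurable_compose[OF measurable_snd borel_measurable_lebesgue_ident] by auto
  show ?thesis by measurable
qed

lemma powr_add_le:
  fixes a b p :: real
  assumes "0 < p"
  shows "\<bar>a + b\<bar> powr p \<le> 2 powr p * (\<bar>a\<bar> powr p + \<bar>b\<bar> powr p)"
proof -
  have "\<bar>a + b\<bar> powr p \<le> (2 * max \<bar>a\<bar> \<bar>b\<bar>) powr p"
    using assms by (intro powr_mono2) auto
  also have "\<dots> = 2 powr p * max \<bar>a\<bar> \<bar>b\<bar> powr p"
    by (simp add: powr_mult)
  also have "max \<bar>a\<bar> \<bar>b\<bar> powr p \<le> \<bar>a\<bar> powr p + \<bar>b\<bar> powr p"
    by (auto simp: max_def)
  finally show ?thesis by simp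
qed

lemma ennreal_powr_add_le:
  assumes "0 < p"
  shows "ennreal (\<bar>a + b\<bar> powr p)
    \<le> ennreal (2 powr p) * (ennreal (\<bar>a\<bar> powr p) + ennreal (\<bar>b\<bar> powr p))"
  using powr_add_le[OF assms, of a b]
  by (simp add: ennreal_mult'[symmetric] ennreal_plus[symmetric] del: ennreal_plus)

text \<open>Only scales with \<open>d <= (1/2)^k\<close> contribute, and their weights grow by a
  factor of at least 2 per step. The sum is thus at most twice its last term, which is at most
  \<open>1 / d^N\<close>.\<close>

lemma sum_dyadic_scales_le:
  fixes d :: real
  assumes "0 < d" "0 < N"
  shows "(\<Sum>k<m. if d \<le> (1/2)^k then 2^(k*N) else 0) \<le> (if d \<le> 1 then 2 / d^N else 0)"
proof (induction m)
  case 0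
  then show ?case using assms by simp
next
  case (Suc m)
  show ?case
  proof (cases "d \<le> (1/2)^m")
    \<comment> \<open>Here \<open>d\<close> lies below all scales up to \<open>m\<close>, so the
      whole geometric sum is present. In the other case the new summand is zero.\<close>
    case True
    have geo: "(\<Sum>k<Suc n. (2::real)^(k*N)) \<le> 2 * 2^(n*N)" for n
    proof (induction n)
      case (Suc n)
      have "(2::real) * 2^(n*N) \<le> 2^(Suc n*N)"
        using power_increasing[of 1 N "2::real"] assms by (simp add: power_add)
      with Suc show ?case by simp
    qed simp
    have "(\<Sum>k<Suc m. if d \<le> (1/2)^k then 2^(k*N) else 0) \<le> (\<Sum>k<Suc m. (2::real)^(k*N))"
      by (intro sum_mono) auto
    also have "\<dots> \<le> 2 * 2^(m*N)" by (rule geo)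
    also have "2^(m*N) = 1 / (((1/2)^m)^N :: real)"
      by (simp add: power_mult power_one_over)
    also have "2 * \<dots> \<le> 2 * (1 / d^N)"
      using assms True by (intro mult_left_mono divide_left_mono power_mono mult_pos_pos) auto
    finally show ?thesis
      using order_trans[OF True power_le_one[of "1/2" m]] by simp
  qed (use Suc in simp)
qed

text \<open>The energy without its normalising constant, written as an iterated integral so that the
  inner integral at a fixed point can be estimated on its own.\<close>

definition log_energy :: "real \<Rightarrow> (real ^ 'n \<Rightarrow> real) \<Rightarrow> ennreal" where
  "log_energy p u = (\<integral>\<^sup>+ x. \<integral>\<^sup>+ y.
     (if dist x y \<le> 1 then ennreal (\<bar>u x - u y\<bar> powr p / dist x y ^ CARD('n)) else 0)
     \<partial>lebesgue \<partial>lebesgue)"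

lemma X_energy_eq_log_energy:
  fixes u :: "real ^ 'n \<Rightarrow> real"
  assumes [measurable]: "u \<in> borel_measurable lebesgue"
  shows "X_energy p u = ennreal (C_Np CARD('n) p) * log_energy p u"
proof -
  have "(\<integral>\<^sup>+ z \<in> {(x, y). norm (x - y) \<le> 1}.
        (case z of (x, y) \<Rightarrow> ennreal (\<bar>u x - u y\<bar> powr p / norm (x - y) ^ CARD('n)))
      \<partial>(lebesgue \<Otimes>\<^sub>M lebesgue)) =
      (\<integral>\<^sup>+ z. (\<lambda>(x, y). if dist x y \<le> 1
         then ennreal (\<bar>u x - u y\<bar> powr p / dist x y ^ CARD('n)) else 0) z
      \<partial>(lebesgue \<Otimes>\<^sub>M lebesgue))"
    by (intro nn_integral_cong) (auto simp: dist_norm split: split_indicator)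
  also have "\<dots> = log_energy p u"
  proof -
    have "(\<lambda>(x, y). if dist x y \<le> 1 then ennreal (\<bar>u x - u y\<bar> powr p / dist x y ^ CARD('n)) else 0)
      \<in> borel_measurable (lebesgue \<Otimes>\<^sub>M lebesgue)"
      by measurable
    from lebesgue.nn_integral_fst[OF this] show ?thesis
      by (simp add: log_energy_def)
  qed
  finally show ?thesis by (simp add: X_energy_def)
qed

lemma C_Np_pos: "0 < p \<Longrightarrow> 0 < N \<Longrightarrow> 0 < C_Np N p"
  by (simp add: C_Np_def)

lemma log_energy_cmult:
  fixes u :: "real ^ 'n \<Rightarrow> real"
  assumes [measurable]: "u \<in> borel_measurable lebesgue" and "0 \<le> c"
  shows "log_energy p (\<lambda>x. c * u x) = ennreal (c powr p) * log_energy p u"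
proof -
  have "(if dist x y \<le> 1 then ennreal (\<bar>c * u x - c * u y\<bar> powr p / dist x y ^ CARD('n)) else 0)
    = ennreal (c powr p) * (if dist x y \<le> 1 then ennreal (\<bar>u x - u y\<bar> powr p / dist x y ^ CARD('n)) else 0)"
    for x y
    using \<open>0 \<le> c\<close> by (auto simp: right_diff_distrib[symmetric] abs_mult powr_mult ennreal_mult'[symmetric])
  then show ?thesis
    unfolding log_energy_def by (simp add: nn_integral_cmult)
qed

text \<open>A quasi-triangle inequality with factor \<open>2 powr p\<close>, obtained pointwise in
  place of Minkowski's inequality. It keeps the differences of a bounded sequence bounded.\<close>

lemma log_energy_diff_le:
  fixes u v :: "real ^ 'n \<Rightarrow> real"
  assumes [measurable]: "u \<in> borel_measurable lebesgue" "v \<in> borel_measurable lebesgue" and "0 < p"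
  shows "log_energy p (\<lambda>x. u x - v x) \<le> ennreal (2 powr p) * (log_energy p u + log_energy p v)"
proof -
  let ?K = "\<lambda>u x y. if dist x y \<le> 1
    then ennreal (\<bar>u x - u y :: real\<bar> powr p / dist x y ^ CARD('n)) else 0"
  have "?K (\<lambda>x. u x - v x) x y \<le> ennreal (2 powr p) * (?K u x y + ?K v x y)" for x y
  proof (cases "dist x y \<le> 1")
    case True
    have "\<bar>(u x - v x) - (u y - v y)\<bar> powr p \<le> 2 powr p * (\<bar>u x - u y\<bar> powr p + \<bar>v x - v y\<bar> powr p)"
      using powr_add_le[OF \<open>0 < p\<close>, of "u x - u y" "v y - v x"] by (simp add: algebra_simps abs_minus_commute)
    then have "\<bar>(u x - v x) - (u y - v y)\<bar> powr p / dist x y ^ CARD('n)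
        \<le> 2 powr p * (\<bar>u x - u y\<bar> powr p / dist x y ^ CARD('n) + \<bar>v x - v y\<bar> powr p / dist x y ^ CARD('n))"
      by (auto simp: add_divide_distrib[symmetric] intro: divide_right_mono)
    then show ?thesis
      using True by (simp add: ennreal_mult'[symmetric] ennreal_plus[symmetric] del: ennreal_plus)
  qed simp
  then have "log_energy p (\<lambda>x. u x - v x)
    \<le> (\<integral>\<^sup>+x. \<integral>\<^sup>+y. ennreal (2 powr p) * (?K u x y + ?K v x y) \<partial>lebesgue \<partial>lebesgue)"
    unfolding log_energy_def by (intro nn_integral_mono)
  also have "\<dots> = ennreal (2 powr p) * (log_energy p u + log_energy p v)"
    unfolding log_energy_def by (simp add: nn_integral_cmult nn_integral_add)
  finally show ?thesis .
qed

section \<open>The logarithmic modular bound\<close>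

text \<open>Cancellation in \<open>ennreal\<close> is legitimate because \<open>A\<close> is finite.
  In the application \<open>2 * c\<close> is the volume of a ball and \<open>A\<close> the measure
  of a bad set that fills at most half of it.\<close>

lemma ennreal_half_le_of_le_add:
  assumes "ennreal (2 * c) \<le> B + A" "A \<le> ennreal c" "0 \<le> c"
  shows "ennreal c \<le> B"
proof (cases B)
  case (real b)
  obtain a where a: "A = ennreal a" "0 \<le> a" "a \<le> c"
    using assms(2,3) by (cases A) (auto simp: top_unique)
  then have "2 * c \<le> b + a"
    using assms(1) real by (simp add: ennreal_plus[symmetric] del: ennreal_plus)
  then show ?thesis using a real by simp
qed simp

text \<open>The hypothesis on \<open>m\<close> says that \<open>{|u| > t}\<close> fills at most half
  of a ball of radius \<open>2^-m\<close>, hence of every larger one. Each scale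
  \<open>k < m\<close> contributes the same amount, because the weight \<open>2^(k*N)\<close>
  cancels the volume of the ball. This is the origin of the factor \<open>m\<close>, which later
  becomes a logarithm.\<close>

lemma inner_energy_ge:
  fixes u :: "real ^ 'n \<Rightarrow> real"
  assumes [measurable]: "u \<in> borel_measurable lebesgue"
    and p: "0 < p" and \<Lambda>: "0 < \<Lambda>" and Lp: "(\<integral>\<^sup>+y. ennreal (\<bar>u y\<bar> powr p) \<partial>lebesgue) \<le> ennreal \<Lambda>"
    and t: "0 < t" "2 * t \<le> \<bar>u x\<bar>"
    and m: "2 ^ (m * CARD('n)) * (2 * \<Lambda>) \<le> unit_ball_vol CARD('n) * t powr p"
  shows "ennreal (t powr p * real m * unit_ball_vol CARD('n) / 4)
    \<le> (\<integral>\<^sup>+y. (if dist x y \<le> 1 then ennreal (\<bar>u x - u y\<bar> powr p / dist x y ^ CARD('n)) else 0) \<partial>lebesgue)"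
proof -
  define N where "N = CARD('n)"
  define \<omega> where "\<omega> = unit_ball_vol (real N)"
  define A where "A = {y. t < \<bar>u y\<bar>}"
  have N: "0 < N" by (simp add: N_def)
  have \<omega>: "0 < \<omega>" by (simp add: \<omega>_def)
  have A [measurable]: "A \<in> sets lebesgue"
  proof -
    have "{y \<in> space lebesgue. t < \<bar>u y\<bar>} \<in> sets lebesgue" by measurable
    then show ?thesis by (simp add: A_def)
  qed
  have cb [measurable]: "cball x r \<in> sets lebesgue" for r by simp
  have tp: "0 < t powr p" using t by simp
  \<comment> \<open>Markov's inequality; the infinite value is excluded before dividing.\<close>
  have muA: "emeasure lebesgue A \<le> ennreal (\<Lambda> / t powr p)"
  proof -
    have "ennreal (t powr p) * emeasure lebesgue A = (\<integral>\<^sup>+y. ennreal (t powr p) * indicator A y \<partial>lebesgue)"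
      by (simp add: nn_integral_cmult_indicator)
    also have "\<dots> \<le> (\<integral>\<^sup>+y. ennreal (\<bar>u y\<bar> powr p) \<partial>lebesgue)"
      using t p by (intro nn_integral_mono)
        (auto simp: A_def split: split_indicator intro!: ennreal_leI powr_mono2)
    also note Lp
    finally have *: "ennreal (t powr p) * emeasure lebesgue A \<le> ennreal \<Lambda>" .
    show ?thesis
    proof (cases "emeasure lebesgue A")
      case (real r)
      then have "t powr p * r \<le> \<Lambda>" using * \<Lambda> by (simp add: ennreal_mult'[symmetric])
      then show ?thesis using real tp by (auto intro!: ennreal_leI simp: field_simps)
    next
      case top
      then show ?thesis using * tp by (simp add: ennreal_mult_top top_unique)
    qed
  qed
  have muD: "ennreal (\<omega> / 2 * (1/2)^(k*N)) \<le> emeasure lebesgue (cball x ((1/2)^k) - A)" if "k < m" for k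
  proof (rule ennreal_half_le_of_le_add)
    have "ennreal (2 * (\<omega> / 2 * (1/2)^(k*N))) = emeasure lebesgue (cball x ((1/2)^k))"
      by (simp add: emeasure_cball \<omega>_def N_def power_mult)
    also have "\<dots> \<le> emeasure lebesgue ((cball x ((1/2)^k) - A) \<union> A)"
      by (intro emeasure_mono) auto
    also have "\<dots> \<le> emeasure lebesgue (cball x ((1/2)^k) - A) + emeasure lebesgue A"
      by (intro emeasure_subadditive) auto
    finally show "ennreal (2 * (\<omega> / 2 * (1/2)^(k*N)))
      \<le> emeasure lebesgue (cball x ((1/2)^k) - A) + emeasure lebesgue A" .
    have "\<Lambda> / t powr p \<le> \<omega> / 2 * (1/2)^(m*N)"
      using m tp \<Lambda> by (simp add: field_simps \<omega>_def N_def)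
    also have "\<dots> \<le> \<omega> / 2 * (1/2)^(k*N)"
      using that \<omega> by (intro mult_left_mono power_decreasing) auto
    finally show "emeasure lebesgue A \<le> ennreal (\<omega> / 2 * (1/2)^(k*N))"
      using muA order_trans ennreal_leI by blast
  qed (use \<omega> in simp)
  \<comment> \<open>The division of the weight \<open>2^(k*N)\<close> by 2 anticipates the factor 2
    in \<open>sum_dyadic_scales_le\<close>.\<close>
  have "ennreal (t powr p * real m * \<omega> / 4)
      = (\<Sum>k<m. ennreal (t powr p * 2^(k*N) / 2 * (\<omega> / 2 * (1/2)^(k*N))))"
  proof -
    have "t powr p * 2^(k*N) / 2 * (\<omega> / 2 * (1/2)^(k*N)) = t powr p * \<omega> / 4" for k
      by (simp add: power_one_over)
    then show ?thesis
      using \<omega> tp by (simp add: ennreal_of_nat_eq_real_of_nat ennreal_mult'[symmetric] mult_ac)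
  qed
  also have "\<dots> = (\<Sum>k<m. ennreal (t powr p * 2^(k*N) / 2) * ennreal (\<omega> / 2 * (1/2)^(k*N)))"
    using \<omega> by (intro sum.cong refl ennreal_mult) auto
  also have "\<dots> \<le> (\<Sum>k<m. ennreal (t powr p * 2^(k*N) / 2) * emeasure lebesgue (cball x ((1/2)^k) - A))"
    by (intro sum_mono mult_left_mono muD) auto
  also have "\<dots> = (\<integral>\<^sup>+y. (\<Sum>k<m. ennreal (t powr p * 2^(k*N) / 2) * indicator (cball x ((1/2)^k) - A) y) \<partial>lebesgue)"
    by (subst nn_integral_sum) (auto simp: nn_integral_cmult_indicator)
  also have "\<dots> \<le> (\<integral>\<^sup>+y. (if dist x y \<le> 1 then ennreal (\<bar>u x - u y\<bar> powr p / dist x y ^ CARD('n)) else 0) \<partial>lebesgue)"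
  proof (intro nn_integral_mono)
    fix y
    show "(\<Sum>k<m. ennreal (t powr p * 2^(k*N) / 2) * indicator (cball x ((1/2)^k) - A) y)
      \<le> (if dist x y \<le> 1 then ennreal (\<bar>u x - u y\<bar> powr p / dist x y ^ CARD('n)) else 0)"
    \<comment> \<open>On \<open>A\<close> all indicators vanish. Off \<open>A\<close>,
      \<open>|u y| <= t\<close> while \<open>|u x| >= 2 * t\<close>, so the increment is at least
      \<open>t\<close>, and \<open>x\<close> and \<open>y\<close> are distinct.\<close>
    proof (cases "y \<in> A")
      case False
      then have uy: "\<bar>u y\<bar> \<le> t" by (simp add: A_def)
      then have d: "0 < dist x y" using t by auto
      have "(\<Sum>k<m. ennreal (t powr p * 2^(k*N) / 2) * indicator (cball x ((1/2)^k) - A) y)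
        = (\<Sum>k<m. ennreal (t powr p / 2 * (if dist x y \<le> (1/2)^k then 2^(k*N) else 0)))"
        using False by (intro sum.cong) (auto split: split_indicator)
      also have "\<dots> = ennreal (t powr p / 2 * (\<Sum>k<m. if dist x y \<le> (1/2)^k then 2^(k*N) else 0))"
        using tp by (subst sum_ennreal) (auto simp: sum_distrib_left)
      also have "\<dots> \<le> ennreal (t powr p / 2 * (if dist x y \<le> 1 then 2 / dist x y ^ N else 0))"
        using tp by (intro ennreal_leI mult_left_mono sum_dyadic_scales_le d N) auto
      also have "\<dots> \<le> (if dist x y \<le> 1 then ennreal (\<bar>u x - u y\<bar> powr p / dist x y ^ CARD('n)) else 0)"
      proof -
        have "t powr p \<le> \<bar>u x - u y\<bar> powr p"
          using t uy p by (intro powr_mono2) auto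
        then show ?thesis using d by (auto simp: N_def intro!: ennreal_leI divide_right_mono)
      qed
      finally show ?thesis .
    qed simp
  qed
  finally show ?thesis by (simp add: \<omega>_def N_def)
qed

text \<open>\<open>m\<close> counts the scales available at height \<open>s\<close>: it is the
  integer part of the logarithm of \<open>\<kappa> * (s / 2) powr p\<close> to base
  \<open>2^N\<close>. This grows like \<open>ln s\<close>, so it controls the logarithm up to
  constants independent of \<open>s\<close>.\<close>

lemma ln_le_dyadic_scale:
  fixes \<kappa> p :: real and N :: nat
  assumes "0 < \<kappa>" "0 < p" "0 < N"
  obtains a b where "0 \<le> a" "0 \<le> b"
    "\<And>s. 0 \<le> s \<Longrightarrow> \<exists>m::nat. (m = 0 \<or> 2 ^ (m * N) \<le> \<kappa> * (s / 2) powr p) \<and>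
        ln (exp 1 + s) \<le> a + b * real m"
proof
  \<comment> \<open>\<open>?b\<close> converts a number of scales into \<open>ln s\<close>. In
    \<open>?a\<close>, \<open>ln 4\<close> comes from bounding \<open>exp 1 + s\<close> by
    \<open>4\<close> or \<open>4 * s\<close>, \<open>ln 2\<close> from halving \<open>s\<close>, and
    the rest from rounding down and from \<open>\<kappa>\<close>.\<close>
  let ?a = "ln 4 + ln 2 + (real N * ln 2 + \<bar>ln \<kappa>\<bar>) / p" and ?b = "real N * ln 2 / p"
  show "0 \<le> ?a" "0 \<le> ?b" using assms by auto
  fix s :: real assume s: "0 \<le> s"
  have e3: "exp (1::real) \<le> 3" by (rule exp_le)
  show "\<exists>m::nat. (m = 0 \<or> 2 ^ (m * N) \<le> \<kappa> * (s / 2) powr p) \<and> ln (exp 1 + s) \<le> ?a + ?b * real m"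
  proof (cases "s < 1")
    case True
    have "ln (exp 1 + s) \<le> ln 4"
      using e3 True s by (subst ln_le_cancel_iff) (auto intro: add_pos_nonneg)
    moreover have "0 \<le> ln 2 + (real N * ln 2 + \<bar>ln \<kappa>\<bar>) / p" using assms by simp
    ultimately have "ln (exp 1 + s) \<le> ?a + ?b * real 0" by simp
    then show ?thesis by (intro exI[of _ 0] conjI disjI1 refl)
  next
    case False
    then have s1: "1 \<le> s" by simp
    define L where "L = ln \<kappa> + p * (ln s - ln 2)"
    define z where "z = L / (real N * ln 2)"
    \<comment> \<open>A negative \<open>z\<close> yields \<open>m = 0\<close>, the case in which
      nothing is claimed about \<open>2^(m*N)\<close>.\<close>
    define m where "m = nat \<lfloor>z\<rfloor>"
    have Nl: "0 < real N * ln 2" using assms by simp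
    have L: "L = ln (\<kappa> * (s / 2) powr p)"
      using assms s1 by (simp add: L_def ln_mult ln_div)
    have zm: "z \<le> real m + 1" unfolding m_def by linarith
    have "2 ^ (m * N) \<le> \<kappa> * (s / 2) powr p" if "m \<noteq> 0"
    proof -
      have "real m \<le> z" using that unfolding m_def by linarith
      then have "real m * (real N * ln 2) \<le> L" using Nl by (simp add: z_def pos_le_divide_eq)
      then have "ln ((2::real) ^ (m * N)) \<le> ln (\<kappa> * (s / 2) powr p)"
        unfolding L[symmetric] by (simp add: ln_realpow mult_ac)
      then show ?thesis using assms s1 by (subst (asm) ln_le_cancel_iff) auto
    qed
    moreover have "ln (exp 1 + s) \<le> ?a + ?b * real m"
    proof -
      have *: "((real m + 1) * c + d) / p = (c + d) / p + c / p * real m" for c d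
        by (simp add: add_divide_distrib distrib_left distrib_right mult.commute)
      have "ln (exp 1 + s) \<le> ln (4 * s)"
        using e3 s1 by (subst ln_le_cancel_iff) (auto intro: add_pos_pos)
      also have "\<dots> = ln 4 + ln s" using s1 by (simp add: ln_mult)
      finally have "ln (exp 1 + s) \<le> ln 4 + ln s" .
      moreover have "ln s \<le> ln 2 + ((real m + 1) * (real N * ln 2) + \<bar>ln \<kappa>\<bar>) / p"
      proof -
        have "L \<le> (real m + 1) * (real N * ln 2)"
          using zm Nl by (simp add: z_def pos_divide_le_eq)
        then have "p * (ln s - ln 2) \<le> (real m + 1) * (real N * ln 2) + \<bar>ln \<kappa>\<bar>"
          unfolding L_def by linarith
        then have "ln s - ln 2 \<le> ((real m + 1) * (real N * ln 2) + \<bar>ln \<kappa>\<bar>) / p"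
          using assms by (subst pos_le_divide_eq) (simp_all add: mult.commute)
        then show ?thesis by simp
      qed
      ultimately show ?thesis
        using *[of "real N * ln 2" "\<bar>ln \<kappa>\<bar>"] by linarith
    qed
    ultimately show ?thesis by (intro exI[of _ m] conjI) auto
  qed
qed

text \<open>\<open>inner_energy_ge\<close> is applied at each \<open>x\<close> with
  \<open>t = |u x| / 2\<close> and the scale count of \<open>ln_le_dyadic_scale\<close>, and the
  result is integrated over \<open>x\<close>. The constants see \<open>u\<close> only through the
  bound \<open>\<Lambda>\<close>.\<close>

lemma log_modular_le:
  assumes "0 < p" "0 < \<Lambda>"
  obtains a b :: real where "0 \<le> a" "0 \<le> b"
    "\<And>u :: real ^ 'n \<Rightarrow> real. u \<in> borel_measurable lebesgue \<Longrightarrow>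
      (\<integral>\<^sup>+x. ennreal (\<bar>u x\<bar> powr p) \<partial>lebesgue) \<le> ennreal \<Lambda> \<Longrightarrow>
      (\<integral>\<^sup>+x. ennreal (\<bar>u x\<bar> powr p * ln (exp 1 + \<bar>u x\<bar>)) \<partial>lebesgue)
        \<le> ennreal a * (\<integral>\<^sup>+x. ennreal (\<bar>u x\<bar> powr p) \<partial>lebesgue) + ennreal b * log_energy p u"
proof -
  let ?\<omega> = "unit_ball_vol (real CARD('n))"
  have \<omega>: "0 < ?\<omega>" by simp
  have \<kappa>: "0 < ?\<omega> / (2 * \<Lambda>)" using \<omega> assms by (intro divide_pos_pos) auto
  obtain a b where ab: "0 \<le> a" "0 \<le> b" and m: "\<And>s. 0 \<le> s \<Longrightarrow>
      \<exists>m::nat. (m = 0 \<or> 2 ^ (m * CARD('n)) \<le> ?\<omega> / (2 * \<Lambda>) * (s / 2) powr p) \<and>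
        ln (exp 1 + s) \<le> a + b * real m"
    using ln_le_dyadic_scale[OF \<kappa> \<open>0 < p\<close> zero_less_card_finite[where 'a = 'n]] by blast
  \<comment> \<open>Undoes the factors \<open>(1/2) powr p\<close> and \<open>?\<omega> / 4\<close>
    of the inner bound.\<close>
  define b' where "b' = b * 2 powr p * 4 / ?\<omega>"
  have b': "0 \<le> b'" using ab by (simp add: b'_def)
  show ?thesis
  proof (rule that[OF ab(1) b'])
    fix u :: "real ^ 'n \<Rightarrow> real"
    assume u [measurable]: "u \<in> borel_measurable lebesgue"
      and Lp: "(\<integral>\<^sup>+x. ennreal (\<bar>u x\<bar> powr p) \<partial>lebesgue) \<le> ennreal \<Lambda>"
    let ?I = "\<lambda>x. \<integral>\<^sup>+y. (if dist x y \<le> 1 then ennreal (\<bar>u x - u y\<bar> powr p / dist x y ^ CARD('n)) else 0) \<partial>lebesgue"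
    have "ennreal (\<bar>u x\<bar> powr p * ln (exp 1 + \<bar>u x\<bar>)) \<le> ennreal a * ennreal (\<bar>u x\<bar> powr p) + ennreal b' * ?I x" for x
    proof (cases "u x = 0")
      case False
      define s where "s = \<bar>u x\<bar>"
      have s: "0 < s" using False by (simp add: s_def)
      obtain k :: nat where k: "k = 0 \<or> 2 ^ (k * CARD('n)) \<le> ?\<omega> / (2 * \<Lambda>) * (s / 2) powr p"
        "ln (exp 1 + s) \<le> a + b * real k"
        using m[of s] s by auto
      have I: "ennreal ((s/2) powr p * real k * ?\<omega> / 4) \<le> ?I x"
      proof (cases "k = 0")
        case False
        then have "2 ^ (k * CARD('n)) \<le> ?\<omega> * (s / 2) powr p / (2 * \<Lambda>)" using k by simp
        then have "2 ^ (k * CARD('n)) * (2 * \<Lambda>) \<le> ?\<omega> * (s / 2) powr p"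
          using assms by (subst (asm) pos_le_divide_eq) auto
        then show ?thesis
          using s by (intro inner_energy_ge[OF u \<open>0 < p\<close> \<open>0 < \<Lambda>\<close> Lp]) (simp_all add: s_def)
      qed simp
      have "s powr p * ln (exp 1 + s) \<le> s powr p * (a + b * real k)"
        using k(2) by (intro mult_left_mono) auto
      also have "\<dots> = a * s powr p + b' * ((s/2) powr p * real k * ?\<omega> / 4)"
        using s less_imp_neq[OF \<omega>] by (simp add: b'_def powr_divide field_simps)
      finally have "ennreal (s powr p * ln (exp 1 + s))
          \<le> ennreal (a * s powr p + b' * ((s/2) powr p * real k * ?\<omega> / 4))"
        by (rule ennreal_leI)
      also have "\<dots> = ennreal a * ennreal (s powr p) + ennreal b' * ennreal ((s/2) powr p * real k * ?\<omega> / 4)"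
        using ab b' \<omega> by (simp add: ennreal_mult'[symmetric] ennreal_plus[symmetric] del: ennreal_plus)
      also have "\<dots> \<le> ennreal a * ennreal (s powr p) + ennreal b' * ?I x"
        by (intro add_left_mono mult_left_mono I) auto
      finally show ?thesis by (simp add: s_def)
    qed simp
    then have "(\<integral>\<^sup>+x. ennreal (\<bar>u x\<bar> powr p * ln (exp 1 + \<bar>u x\<bar>)) \<partial>lebesgue)
      \<le> (\<integral>\<^sup>+x. ennreal a * ennreal (\<bar>u x\<bar> powr p) + ennreal b' * ?I x \<partial>lebesgue)"
      by (intro nn_integral_mono)
    also have "\<dots> = ennreal a * (\<integral>\<^sup>+x. ennreal (\<bar>u x\<bar> powr p) \<partial>lebesgue) + ennreal b' * log_energy p u"
      by (simp add: nn_integral_add nn_integral_cmult log_energy_def)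
    finally show "(\<integral>\<^sup>+x. ennreal (\<bar>u x\<bar> powr p * ln (exp 1 + \<bar>u x\<bar>)) \<partial>lebesgue)
      \<le> ennreal a * (\<integral>\<^sup>+x. ennreal (\<bar>u x\<bar> powr p) \<partial>lebesgue) + ennreal b' * log_energy p u" .
  qed
qed

section \<open>The continuous embedding\<close>

lemma X_space_borel_measurable:
  assumes "u \<in> X_space p \<Omega>" "open \<Omega>"
  shows "u \<in> borel_measurable lebesgue"
proof -
  have "(\<lambda>x. if x \<in> \<Omega> then u x else 0) \<in> borel_measurable lebesgue"
    using assms by (intro borel_measurable_if_I) (auto simp: X_space_def)
  also have "(\<lambda>x. if x \<in> \<Omega> then u x else 0) = u"
    using assms by (auto simp: X_space_def)
  finally show ?thesis .
qed

lemma Lp_modular_eq_lebesgue: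
  assumes "u \<in> X_space p \<Omega>" "open \<Omega>"
  shows "Lp_modular p \<Omega> u = (\<integral>\<^sup>+x. ennreal (\<bar>u x\<bar> powr p) \<partial>lebesgue)"
  unfolding Lp_modular_def using assms
  by (subst nn_integral_restrict_space)
    (auto simp: X_space_def split: split_indicator intro!: nn_integral_cong)

lemma log_energy_finite:
  fixes u :: "real ^ 'n \<Rightarrow> real"
  assumes "u \<in> X_space p \<Omega>" "open \<Omega>" "0 < p"
  shows "log_energy p u < \<infinity>"
proof -
  have "ennreal (C_Np CARD('n) p) * log_energy p u < \<infinity>"
    using assms X_energy_eq_log_energy[OF X_space_borel_measurable[OF assms(1,2)]]
    by (auto simp: X_space_def)
  then show ?thesis
    using C_Np_pos[OF \<open>0 < p\<close>, of "CARD('n)"] by (auto simp: ennreal_mult_less_top)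
qed

text \<open>The \<open>p\<close>-th power of the norm is a sum of two finite nonnegative terms, so
  it bounds each of them.\<close>

lemma X_norm_le_imp:
  fixes u :: "real ^ 'n \<Rightarrow> real"
  assumes "u \<in> X_space p \<Omega>" "open \<Omega>" "0 < p" "X_norm p \<Omega> u \<le> c"
  shows "(\<integral>\<^sup>+x. ennreal (\<bar>u x\<bar> powr p) \<partial>lebesgue) \<le> ennreal (c powr p)"
    and "log_energy p u \<le> ennreal (c powr p / C_Np CARD('n) p)"
proof -
  let ?C = "C_Np CARD('n) p"
  have C: "0 < ?C" using C_Np_pos[OF \<open>0 < p\<close>, of "CARD('n)"] by simp
  obtain G where G: "log_energy p u = ennreal G" "0 \<le> G"
    using log_energy_finite[OF assms(1-3)] by (cases "log_energy p u") auto
  obtain L where L: "(\<integral>\<^sup>+x. ennreal (\<bar>u x\<bar> powr p) \<partial>lebesgue) = ennreal L" "0 \<le> L"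
    using assms(1) Lp_modular_eq_lebesgue[OF assms(1,2)]
    by (cases "\<integral>\<^sup>+x. ennreal (\<bar>u x\<bar> powr p) \<partial>lebesgue") (auto simp: X_space_def)
  have "X_norm p \<Omega> u = (L + ?C * G) powr (1 / p)"
    using L G C X_energy_eq_log_energy[OF X_space_borel_measurable[OF assms(1,2)], of p]
    by (simp add: X_norm_def Lp_modular_eq_lebesgue[OF assms(1,2)] ennreal_mult'[symmetric])
  then have "((L + ?C * G) powr (1 / p)) powr p \<le> c powr p"
    using assms by (intro powr_mono2) auto
  then have le: "L + ?C * G \<le> c powr p"
    using assms(3) L G C by (simp add: powr_powr)
  have "0 \<le> ?C * G" using C G by simp
  with le have "L \<le> c powr p" by linarith
  then show "(\<integral>\<^sup>+x. ennreal (\<bar>u x\<bar> powr p) \<partial>lebesgue) \<le> ennreal (c powr p)"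
    unfolding L by (rule ennreal_leI)
  have "G * ?C \<le> c powr p" using le L by (simp add: mult.commute)
  then have "G \<le> c powr p / ?C" using C by (simp add: pos_le_divide_eq)
  then show "log_energy p u \<le> ennreal (c powr p / ?C)"
    unfolding G by (rule ennreal_leI)
qed

lemma nn_integral_powr_cmult:
  assumes [measurable]: "u \<in> borel_measurable M" and "0 \<le> c"
  shows "(\<integral>\<^sup>+x. ennreal (\<bar>c * u x\<bar> powr p) \<partial>M) = ennreal (c powr p) * (\<integral>\<^sup>+x. ennreal (\<bar>u x\<bar> powr p) \<partial>M)"
  using assms(2) by (simp add: abs_mult powr_mult ennreal_mult' nn_integral_cmult)

lemma Orlicz_modular_le_lebesgue:
  assumes "open \<Omega>"
  shows "Orlicz_modular \<theta> \<Omega> u \<le> (\<integral>\<^sup>+x. \<theta> \<bar>u x\<bar> \<partial>lebesgue)"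
  unfolding Orlicz_modular_def using assms
  by (subst nn_integral_restrict_space) (auto split: split_indicator intro!: nn_integral_mono)

text \<open>Since \<open>K <= K powr p\<close> and the logarithm is monotone, dividing the argument
  by \<open>K\<close> divides the value at least by \<open>K\<close>. This turns a bound on the
  modular into one on the Luxemburg norm.\<close>

lemma powr_ln_divide_le:
  fixes t K p :: real
  assumes "0 \<le> t" "1 \<le> K" "1 \<le> p"
  shows "(t / K) powr p * ln (exp 1 + t / K) \<le> t powr p * ln (exp 1 + t) / K"
proof -
  have "t / K \<le> t" using assms by (simp add: pos_divide_le_eq mult_le_cancel_left1)
  then have 1: "ln (exp 1 + t / K) \<le> ln (exp 1 + t)"
    using assms by (subst ln_le_cancel_iff) (auto intro: add_pos_nonneg)
  have 0: "0 \<le> ln (exp 1 + t)"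
    using assms by (intro ln_ge_zero) (auto intro: add_increasing2)
  have "K powr 1 \<le> K powr p" using assms by (intro powr_mono) auto
  then have "t powr p / K powr p \<le> t powr p / K"
    using assms by (intro divide_left_mono) (auto intro: mult_pos_pos)
  then have "(t / K) powr p * ln (exp 1 + t / K) \<le> t powr p / K * ln (exp 1 + t)"
    using assms 0 1 by (intro mult_mono) (auto simp: powr_divide intro!: ln_ge_zero add_increasing2)
  then show ?thesis by simp
qed

text \<open>Divided by \<open>c\<close>, the function has \<open>L^p\<close> modular at most 1 and
  controlled energy, so \<open>log_modular_le\<close> with \<open>\<Lambda> = 1\<close> bounds its
  logarithmic modular by a fixed \<open>K'\<close>. A further division by \<open>K\<close> brings
  the modular of \<open>\<theta>\<close> below 1. The free factor \<open>A\<close> lets the lemma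
  serve both \<open>\<phi>\<close> and \<open>\<psi>\<close>.\<close>

lemma continuous_embedding_of_growth:
  fixes \<Omega> :: "(real ^ 'n) set"
  assumes p: "1 < p" and \<Omega>: "open \<Omega>" and A: "0 \<le> A"
    and \<theta>: "\<And>t. 0 \<le> t \<Longrightarrow> \<theta> t \<le> A * (t powr p * ln (exp 1 + t))"
  shows "continuous_embedding (X_space p \<Omega>) (X_norm p \<Omega>)
    (Orlicz_space (\<lambda>t. ennreal (\<theta> t)) \<Omega>) (Luxemburg_norm (\<lambda>t. ennreal (\<theta> t)) \<Omega>)"
proof -
  let ?C = "C_Np CARD('n) p"
  have p0: "0 < p" using p by simp
  have C: "0 < ?C" using C_Np_pos[OF p0, of "CARD('n)"] by simp
  obtain a b where ab: "0 \<le> a" "0 \<le> b" and mod: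
    "\<And>u :: real ^ 'n \<Rightarrow> real. u \<in> borel_measurable lebesgue \<Longrightarrow>
      (\<integral>\<^sup>+x. ennreal (\<bar>u x\<bar> powr p) \<partial>lebesgue) \<le> ennreal 1 \<Longrightarrow>
      (\<integral>\<^sup>+x. ennreal (\<bar>u x\<bar> powr p * ln (exp 1 + \<bar>u x\<bar>)) \<partial>lebesgue)
        \<le> ennreal a * (\<integral>\<^sup>+x. ennreal (\<bar>u x\<bar> powr p) \<partial>lebesgue) + ennreal b * log_energy p u"
    using log_modular_le[OF p0 zero_less_one, where 'n = 'n] by blast
  define K' where "K' = a + b / ?C"
  \<comment> \<open>At least 1 for \<open>powr_ln_divide_le\<close>, and at least
    \<open>A * K'\<close> for a final modular of at most 1.\<close>
  define K where "K = max 1 (A * K')"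
  have K: "1 \<le> K" "A * K' \<le> K" by (auto simp: K_def)
  have K': "0 \<le> K'" using ab C by (simp add: K'_def)
  have key: "Orlicz_modular (\<lambda>t. ennreal (\<theta> t)) \<Omega> (\<lambda>x. u x / (K * c)) \<le> 1"
    if u: "u \<in> X_space p \<Omega>" and c: "0 < c" "X_norm p \<Omega> u \<le> c" for u c
  proof -
    note um [measurable] = X_space_borel_measurable[OF u \<Omega>]
    define w where "w = (\<lambda>x. (1 / c) * u x)"
    have w [measurable]: "w \<in> borel_measurable lebesgue" by (simp add: w_def)
    have cp: "(1 / c) powr p * c powr p = 1" using c by (simp add: powr_divide)
    have wL: "(\<integral>\<^sup>+x. ennreal (\<bar>w x\<bar> powr p) \<partial>lebesgue) \<le> ennreal 1"
    proof -
      have "(\<integral>\<^sup>+x. ennreal (\<bar>w x\<bar> powr p) \<partial>lebesgue)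
          \<le> ennreal ((1 / c) powr p) * ennreal (c powr p)"
        unfolding w_def using c
        by (subst nn_integral_powr_cmult) (auto intro!: mult_left_mono X_norm_le_imp(1)[OF u \<Omega> p0])
      then show ?thesis using cp by (simp add: ennreal_mult'[symmetric])
    qed
    have wE: "log_energy p w \<le> ennreal (1 / ?C)"
    proof -
      have "log_energy p w \<le> ennreal ((1 / c) powr p) * ennreal (c powr p / ?C)"
        unfolding w_def using c
        by (subst log_energy_cmult) (auto intro!: mult_left_mono X_norm_le_imp(2)[OF u \<Omega> p0])
      then show ?thesis using cp C by (simp add: ennreal_mult'[symmetric])
    qed
    have wm: "(\<integral>\<^sup>+x. ennreal (\<bar>w x\<bar> powr p * ln (exp 1 + \<bar>w x\<bar>)) \<partial>lebesgue) \<le> ennreal K'"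
    proof -
      have "(\<integral>\<^sup>+x. ennreal (\<bar>w x\<bar> powr p * ln (exp 1 + \<bar>w x\<bar>)) \<partial>lebesgue)
        \<le> ennreal a * ennreal 1 + ennreal b * ennreal (1 / ?C)"
        using mod[OF w wL] by (rule order_trans) (intro add_mono mult_left_mono wL wE; simp)
      also have "\<dots> = ennreal K'"
        using ab C by (simp add: K'_def ennreal_mult'[symmetric] ennreal_plus[symmetric] del: ennreal_plus)
      finally show ?thesis .
    qed
    have "Orlicz_modular (\<lambda>t. ennreal (\<theta> t)) \<Omega> (\<lambda>x. u x / (K * c))
      \<le> (\<integral>\<^sup>+x. ennreal (\<theta> \<bar>u x / (K * c)\<bar>) \<partial>lebesgue)"
      by (rule Orlicz_modular_le_lebesgue[OF \<Omega>])
    also have "\<dots> \<le> (\<integral>\<^sup>+x. ennreal (A / K) * ennreal (\<bar>w x\<bar> powr p * ln (exp 1 + \<bar>w x\<bar>)) \<partial>lebesgue)"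
    proof (intro nn_integral_mono)
      fix x
      have eq: "\<bar>u x / (K * c)\<bar> = \<bar>w x\<bar> / K"
        using K c by (simp add: w_def abs_mult)
      have "\<theta> (\<bar>w x\<bar> / K) \<le> A * ((\<bar>w x\<bar> / K) powr p * ln (exp 1 + \<bar>w x\<bar> / K))"
        using K by (intro \<theta>) auto
      also have "\<dots> \<le> A * (\<bar>w x\<bar> powr p * ln (exp 1 + \<bar>w x\<bar>) / K)"
        using A K p by (intro mult_left_mono powr_ln_divide_le) auto
      finally have "\<theta> \<bar>u x / (K * c)\<bar> \<le> A / K * (\<bar>w x\<bar> powr p * ln (exp 1 + \<bar>w x\<bar>))"
        unfolding eq by simp
      then show "ennreal (\<theta> \<bar>u x / (K * c)\<bar>) \<le> ennreal (A / K) * ennreal (\<bar>w x\<bar> powr p * ln (exp 1 + \<bar>w x\<bar>))"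
        using A K by (subst ennreal_mult'[symmetric]) (auto intro!: ennreal_leI)
    qed
    also have "\<dots> \<le> ennreal (A / K) * ennreal K'"
      by (subst nn_integral_cmult) (auto intro!: mult_left_mono wm)
    also have "\<dots> \<le> 1"
      using A K by (simp add: ennreal_mult'[symmetric])
    finally show ?thesis .
  qed
  show ?thesis
    unfolding continuous_embedding_def
  proof (intro conjI subsetI exI ballI)
    fix u assume u: "u \<in> X_space p \<Omega>"
    \<comment> \<open>The extra 1 keeps \<open>c\<close> positive when the seminorm
      vanishes.\<close>
    define c where "c = X_norm p \<Omega> u + 1"
    have c: "0 < c" "X_norm p \<Omega> u \<le> c"
      by (auto simp: c_def X_norm_def intro: add_nonneg_pos)
    have "Orlicz_modular (\<lambda>t. ennreal (\<theta> t)) \<Omega> (\<lambda>x. 1 / (K * c) * u x) < \<infinity>"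
      using key[OF u c] by (simp add: less_le_trans le_less_trans)
    moreover have "0 < 1 / (K * c)" using K c by simp
    ultimately show "u \<in> Orlicz_space (\<lambda>t. ennreal (\<theta> t)) \<Omega>"
      using u unfolding Orlicz_space_def X_space_def by blast
  next
    fix u assume u: "u \<in> X_space p \<Omega>"
    let ?n = "X_norm p \<Omega> u"
    \<comment> \<open>The slack \<open>e\<close> again guarantees a positive divisor. It is rescaled
      by \<open>K\<close> and then sent to 0.\<close>
    have "Luxemburg_norm (\<lambda>t. ennreal (\<theta> t)) \<Omega> u \<le> K * (?n + e)" if "0 < e" for e
      unfolding Luxemburg_norm_def
    proof (rule cInf_lower)
      have "0 < ?n + e" using that by (auto simp: X_norm_def intro: add_nonneg_pos)
      then show "K * (?n + e) \<in> {c. 0 < c \<and> Orlicz_modular (\<lambda>t. ennreal (\<theta> t)) \<Omega> (\<lambda>x. u x / c) \<le> 1}"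
        using key[OF u, of "?n + e"] K that by simp
    qed (auto intro: bdd_belowI[of _ 0])
    then have "Luxemburg_norm (\<lambda>t. ennreal (\<theta> t)) \<Omega> u \<le> K * ?n + e" if "0 < e" for e
      using that K by (drule_tac x = "e / K" in meta_spec) (simp add: distrib_left)
    then show "Luxemburg_norm (\<lambda>t. ennreal (\<theta> t)) \<Omega> u \<le> K * ?n"
      by (rule field_le_epsilon)
  qed
qed

section \<open>Oscillation on dyadic cubes\<close>

text \<open>Half-open cubes, represented by their integer indices. The side is
  \<open>1 / (N * 2^j)\<close> with \<open>N\<close> the dimension: the factor \<open>N\<close>
  makes the sum of the coordinate differences, hence the distance, at most \<open>2^-j\<close>
  inside a cube.\<close>

definition grid :: "nat \<Rightarrow> real ^ 'n \<Rightarrow> int ^ 'n" where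
  "grid j x = (\<chi> i. \<lfloor>real CARD('n) * 2 ^ j * x $ i\<rfloor>)"

definition grid_vol :: "'n::finite itself \<Rightarrow> nat \<Rightarrow> real" where
  "grid_vol _ j = (1 / (real CARD('n) * 2 ^ j)) ^ CARD('n)"

lemma grid_vol_pos: "0 < grid_vol TYPE('n::finite) j"
  by (simp add: grid_vol_def)

lemma grid_cell_eq:
  "{x. grid j x = (a :: int ^ 'n)} =
    {x. \<forall>i. real_of_int (a $ i) \<le> real CARD('n) * 2 ^ j * x $ i \<and>
      real CARD('n) * 2 ^ j * x $ i < real_of_int (a $ i) + 1}"
  by (auto simp: grid_def vec_eq_iff floor_eq_iff)

lemma sets_grid_cell [measurable]: "{x. grid j x = a} \<in> sets lebesgue"
proof -
  have "{x. grid j x = a} \<in> sets borel"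
    unfolding grid_cell_eq by measurable
  then show ?thesis by simp
qed

lemma measurable_grid [measurable]: "grid j \<in> lebesgue \<rightarrow>\<^sub>M count_space UNIV"
  by (subst measurable_count_space_eq2_countable) (auto simp: vimage_def)

lemma measurable_grid_eq [measurable]:
  "Measurable.pred (lebesgue \<Otimes>\<^sub>M lebesgue) (\<lambda>z. grid j (fst z) = grid j (snd z))"
proof -
  have "(\<lambda>z. grid j (fst z) = grid j (snd z)) = (\<lambda>z. \<exists>a. grid j (fst z) = a \<and> grid j (snd z) = a)"
    by auto
  then show ?thesis by simp
qed

text \<open>The half-open cube lies between the open and the closed box with the same corners, and
  these have equal volume.\<close>

lemma emeasure_grid_cell:
  "emeasure lebesgue {x :: real ^ 'n. grid j x = a} = ennreal (grid_vol TYPE('n) j)"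
proof -
  let ?s = "real CARD('n) * 2 ^ j"
  let ?l = "(\<chi> i. real_of_int (a $ i) / ?s) :: real ^ 'n" and ?r = "(\<chi> i. (real_of_int (a $ i) + 1) / ?s) :: real ^ 'n"
  have s: "0 < ?s" by simp
  have sub: "box ?l ?r \<subseteq> {x. grid j x = a}" "{x. grid j x = a} \<subseteq> cbox ?l ?r"
    using s unfolding grid_cell_eq
    by (auto simp: mem_box_cart pos_divide_le_eq pos_le_divide_eq pos_divide_less_eq pos_less_divide_eq mult.commute less_imp_le)
  have cont: "measure lborel (cbox ?l ?r) = grid_vol TYPE('n) j"
  proof -
    have "?l $ i \<le> ?r $ i" for i using s by (simp add: divide_right_mono)
    then have "measure lborel (cbox ?l ?r) = (\<Prod>i\<in>UNIV. ?r $ i - ?l $ i)"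
      by (intro content_cbox_cart) (auto simp: interval_ne_empty_cart box_ne_empty)
    also have "\<dots> = grid_vol TYPE('n) j"
      by (simp add: grid_vol_def diff_divide_distrib[symmetric])
    finally show ?thesis .
  qed
  have c: "emeasure lebesgue (cbox ?l ?r) = ennreal (grid_vol TYPE('n) j)"
    using cont emeasure_eq_ennreal_measure[of lborel "cbox ?l ?r"] emeasure_lborel_cbox_finite[of ?l ?r]
    by simp
  have b: "emeasure lebesgue (box ?l ?r) = ennreal (grid_vol TYPE('n) j)"
    using c by (simp add: emeasure_lborel_box_eq emeasure_lborel_cbox_eq)
  show ?thesis
  proof (rule antisym)
    show "emeasure lebesgue {x. grid j x = a} \<le> ennreal (grid_vol TYPE('n) j)"
      unfolding c[symmetric] by (rule emeasure_mono[OF sub(2)]) simp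
    show "ennreal (grid_vol TYPE('n) j) \<le> emeasure lebesgue {x. grid j x = a}"
      unfolding b[symmetric] by (rule emeasure_mono[OF sub(1) sets_grid_cell])
  qed
qed

text \<open>The cubes are nested because coarse indices arise from fine ones by integer division by
  \<open>2^(m-j)\<close>.\<close>

lemma grid_refine:
  assumes "j \<le> m" "grid m x = grid m y"
  shows "grid j x = (grid j y :: int ^ 'n)"
proof -
  have *: "\<lfloor>real CARD('n) * 2 ^ j * z $ i\<rfloor> = \<lfloor>real CARD('n) * 2 ^ m * z $ i\<rfloor> div 2 ^ (m - j)"
    for z :: "real ^ 'n" and i
  proof -
    have "(2::real) ^ m = 2 ^ j * 2 ^ (m - j)" using assms by (simp add: power_add[symmetric])
    then have "real CARD('n) * 2 ^ j * z $ i = real CARD('n) * 2 ^ m * z $ i / real_of_int (2 ^ (m - j))"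
      by simp
    then show ?thesis by (simp only: floor_divide_real_eq_div zero_le_power zero_le_numeral)
  qed
  from assms(2) have "\<lfloor>real CARD('n) * 2 ^ m * x $ i\<rfloor> = \<lfloor>real CARD('n) * 2 ^ m * y $ i\<rfloor>" for i
    by (simp add: grid_def vec_eq_iff)
  then show ?thesis unfolding grid_def vec_eq_iff by (simp add: *)
qed

lemma grid_eq_imp_dist_le:
  fixes x y :: "real ^ 'n"
  assumes "grid j x = grid j y"
  shows "dist x y \<le> (1/2) ^ j"
proof -
  let ?s = "real CARD('n) * 2 ^ j"
  have s: "0 < ?s" by simp
  have "\<bar>(x - y) $ i\<bar> \<le> 1 / ?s" for i
  proof -
    have "\<lfloor>?s * x $ i\<rfloor> = \<lfloor>?s * y $ i\<rfloor>" using assms by (simp add: grid_def vec_eq_iff)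
    then have "\<bar>?s * x $ i - ?s * y $ i\<bar> \<le> 1" by linarith
    then have "?s * \<bar>(x - y) $ i\<bar> \<le> 1" using s by (simp add: right_diff_distrib[symmetric] abs_mult)
    then show ?thesis using s by (simp add: pos_le_divide_eq mult.commute)
  qed
  then have "(\<Sum>i\<in>UNIV. \<bar>(x - y) $ i\<bar>) \<le> (\<Sum>i\<in>(UNIV :: 'n set). 1 / ?s)"
    by (rule sum_mono)
  moreover have "(\<Sum>i\<in>(UNIV :: 'n set). 1 / ?s) = (1/2) ^ j"
    by (simp add: power_one_over)
  ultimately show ?thesis
    using norm_le_l1_cart[of "x - y"] by (simp add: dist_norm)
qed

text \<open>Finitely many cubes meet a bounded set, so the approximating step functions are
  described by finitely many constants at each scale.\<close>

lemma finite_grid_image: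
  fixes \<Omega> :: "(real ^ 'n) set"
  assumes "bounded \<Omega>"
  shows "finite (grid j ` \<Omega>)"
proof -
  let ?s = "real CARD('n) * 2 ^ j"
  have s: "0 < ?s" by simp
  obtain B where B: "\<And>x. x \<in> \<Omega> \<Longrightarrow> norm x \<le> B" using assms unfolding bounded_iff by auto
  let ?S = "{\<lfloor>- (?s * B)\<rfloor>..\<lfloor>?s * B\<rfloor>}"
  have "grid j x \<in> vec_lambda ` PiE UNIV (\<lambda>_. ?S)" if "x \<in> \<Omega>" for x
  proof (intro image_eqI[of _ _ "\<lambda>i. grid j x $ i"] PiE_I)
    fix i
    have "\<bar>x $ i\<bar> \<le> B" using component_le_norm_cart[of x i] B[OF that] by linarith
    then have "\<bar>?s * x $ i\<bar> \<le> ?s * B" using s by (simp add: abs_mult)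
    then show "grid j x $ i \<in> ?S" by (auto simp: grid_def abs_le_iff intro!: floor_mono)
  qed auto
  then have "grid j ` \<Omega> \<subseteq> vec_lambda ` PiE UNIV (\<lambda>_. ?S)" by blast
  moreover have "finite (vec_lambda ` PiE (UNIV :: 'n set) (\<lambda>_. ?S))"
    by (intro finite_imageI finite_PiE) auto
  ultimately show ?thesis by (rule finite_subset)
qed

section \<open>Oscillation over pairs in a common cube, and its decay\<close>

definition cell_energy :: "real \<Rightarrow> nat \<Rightarrow> (real ^ 'n \<Rightarrow> real) \<Rightarrow> ennreal" where
  "cell_energy p j u = (\<integral>\<^sup>+x. \<integral>\<^sup>+y.
     (if grid j x = grid j y then ennreal (\<bar>u x - u y\<bar> powr p) else 0) \<partial>lebesgue \<partial>lebesgue)"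

text \<open>Points in a common cube of scale \<open>j\<close> are at distance at most
  \<open>2^-j\<close>, so \<open>sum_dyadic_scales_le\<close> applies pointwise. Up to a constant
  the weight is the reciprocal cell volume, so each summand is a mean oscillation.\<close>

lemma sum_cell_energy_le:
  fixes u :: "real ^ 'n \<Rightarrow> real"
  assumes [measurable]: "u \<in> borel_measurable lebesgue"
  shows "(\<Sum>j<m. ennreal (2 ^ (j * CARD('n))) * cell_energy p j u) \<le> 2 * log_energy p u"
proof -
  let ?c = "\<lambda>j x y. if grid j x = grid j y then ennreal (\<bar>u x - u y\<bar> powr p) else 0"
  let ?k = "\<lambda>x y. if dist x y \<le> 1 then ennreal (\<bar>u x - u y\<bar> powr p / dist x y ^ CARD('n)) else 0"
  have pw: "(\<Sum>j<m. ennreal (2 ^ (j * CARD('n))) * ?c j x y) \<le> 2 * ?k x y" for x y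
  proof (cases "x = y")
    case False
    then have d: "0 < dist x y" by simp
    have "(\<Sum>j<m. ennreal (2 ^ (j * CARD('n))) * ?c j x y)
      \<le> (\<Sum>j<m. ennreal (\<bar>u x - u y\<bar> powr p * (if dist x y \<le> (1/2)^j then 2 ^ (j * CARD('n)) else 0)))"
      by (intro sum_mono) (auto simp: grid_eq_imp_dist_le ennreal_mult'[symmetric] mult.commute)
    also have "\<dots> = ennreal (\<bar>u x - u y\<bar> powr p * (\<Sum>j<m. if dist x y \<le> (1/2)^j then 2 ^ (j * CARD('n)) else 0))"
      by (subst sum_ennreal) (auto simp: sum_distrib_left)
    also have "\<dots> \<le> ennreal (\<bar>u x - u y\<bar> powr p * (if dist x y \<le> 1 then 2 / dist x y ^ CARD('n) else 0))"
      by (intro ennreal_leI mult_left_mono sum_dyadic_scales_le d) auto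
    also have "\<dots> = 2 * ?k x y"
      by (auto simp: ennreal_mult'[symmetric] ennreal_numeral[symmetric] mult.commute simp del: ennreal_numeral)
    finally show ?thesis .
  qed simp
  have "(\<Sum>j<m. ennreal (2 ^ (j * CARD('n))) * cell_energy p j u)
    = (\<integral>\<^sup>+x. \<integral>\<^sup>+y. (\<Sum>j<m. ennreal (2 ^ (j * CARD('n))) * ?c j x y) \<partial>lebesgue \<partial>lebesgue)"
    unfolding cell_energy_def by (simp add: nn_integral_sum nn_integral_cmult)
  also have "\<dots> \<le> (\<integral>\<^sup>+x. \<integral>\<^sup>+y. 2 * ?k x y \<partial>lebesgue \<partial>lebesgue)"
    by (intro nn_integral_mono pw)
  also have "\<dots> = 2 * log_energy p u"
    unfolding log_energy_def by (simp add: nn_integral_cmult)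
  finally show ?thesis .
qed

lemma nn_integral_grid_cell:
  fixes x :: "real ^ 'n"
  shows "(\<integral>\<^sup>+y. (if grid j x = grid j y then c else 0) \<partial>lebesgue) = ennreal (grid_vol TYPE('n) j) * c"
proof -
  have "(\<integral>\<^sup>+y. (if grid j x = grid j y then c else 0) \<partial>lebesgue)
    = (\<integral>\<^sup>+y. c * indicator {y. grid j y = grid j x} y \<partial>lebesgue)"
    by (intro nn_integral_cong) (auto split: split_indicator)
  then show ?thesis by (simp add: nn_integral_cmult_indicator emeasure_grid_cell mult.commute del: nn_integral_indicator)
qed

text \<open>Mean oscillation nearly decreases under refinement: for \<open>x\<close>,
  \<open>x'\<close> in a common fine cube, \<open>|u x - u x'|\<close> is compared with
  \<open>|u x - u y|\<close> and \<open>|u x' - u y|\<close>, integrated over \<open>y\<close> in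
  the surrounding coarse cube.\<close>

lemma cell_energy_refine_le:
  fixes u :: "real ^ 'n \<Rightarrow> real"
  assumes [measurable]: "u \<in> borel_measurable lebesgue" and p: "0 < p" and jm: "j \<le> m"
  shows "ennreal (grid_vol TYPE('n) j) * cell_energy p m u
    \<le> ennreal (2 * 2 powr p * grid_vol TYPE('n) m) * cell_energy p j u"
proof -
  let ?v = "\<lambda>j. ennreal (grid_vol TYPE('n) j)"
  let ?c = "\<lambda>j x y. if grid j x = grid j y then ennreal (\<bar>u x - u y\<bar> powr p) else 0"
  define G where "G = (\<lambda>x. \<integral>\<^sup>+y. ?c j x y \<partial>lebesgue)"
  have G [measurable]: "G \<in> borel_measurable lebesgue" by (simp add: G_def)
  \<comment> \<open>\<open>G x\<close> does not involve the second argument, so integrating that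
    argument over the fine cube gives the factor \<open>?v m\<close>.\<close>
  let ?H = "\<lambda>x y. if grid m x = grid m y then G x else 0"
  have pw: "?v j * ?c m x x' \<le> ennreal (2 powr p) * (?H x x' + ?H x' x)" for x x'
  proof (cases "grid m x = grid m x'")
    case True
    have j: "grid j x = grid j x'" using grid_refine[OF jm True] .
    \<comment> \<open>The factor \<open>?v j\<close> is read as an integral over the coarse cube,
      which makes room for the intermediate point \<open>y\<close>.\<close>
    have "?v j * ?c m x x' = (\<integral>\<^sup>+y. (if grid j x = grid j y then ennreal (\<bar>u x - u x'\<bar> powr p) else 0) \<partial>lebesgue)"
      using True by (simp add: nn_integral_grid_cell)
    also have "\<dots> \<le> (\<integral>\<^sup>+y. ennreal (2 powr p) * (?c j x y + ?c j x' y) \<partial>lebesgue)"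
    proof (intro nn_integral_mono)
      fix y
      have "ennreal (\<bar>u x - u x'\<bar> powr p)
        \<le> ennreal (2 powr p) * (ennreal (\<bar>u x - u y\<bar> powr p) + ennreal (\<bar>u x' - u y\<bar> powr p))"
        using ennreal_powr_add_le[OF p, of "u x - u y" "u y - u x'"] by (simp add: abs_minus_commute)
      then show "(if grid j x = grid j y then ennreal (\<bar>u x - u x'\<bar> powr p) else 0)
        \<le> ennreal (2 powr p) * (?c j x y + ?c j x' y)"
        using j by auto
    qed
    also have "\<dots> = ennreal (2 powr p) * (G x + G x')"
      by (simp add: nn_integral_cmult nn_integral_add G_def)
    finally show ?thesis using True by simp
  qed simp
  have H1: "(\<integral>\<^sup>+x. \<integral>\<^sup>+x'. ?H x x' \<partial>lebesgue \<partial>lebesgue) = ?v m * cell_energy p j u"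
    by (simp add: nn_integral_grid_cell nn_integral_cmult) (simp add: G_def cell_energy_def)
  have H2: "(\<integral>\<^sup>+x. \<integral>\<^sup>+x'. ?H x' x \<partial>lebesgue \<partial>lebesgue) = ?v m * cell_energy p j u"
  proof -
    have "(\<lambda>(x, y). ?H x y) \<in> borel_measurable (lebesgue \<Otimes>\<^sub>M lebesgue)" by measurable
    from lebesgue_pair.Fubini'[OF this] show ?thesis using H1 by simp
  qed
  have "?v j * cell_energy p m u = (\<integral>\<^sup>+x. \<integral>\<^sup>+x'. ?v j * ?c m x x' \<partial>lebesgue \<partial>lebesgue)"
    by (simp add: cell_energy_def nn_integral_cmult)
  also have "\<dots> \<le> (\<integral>\<^sup>+x. \<integral>\<^sup>+x'. ennreal (2 powr p) * (?H x x' + ?H x' x) \<partial>lebesgue \<partial>lebesgue)"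
    by (intro nn_integral_mono pw)
  also have "\<dots> = ennreal (2 powr p) * ((\<integral>\<^sup>+x. \<integral>\<^sup>+x'. ?H x x' \<partial>lebesgue \<partial>lebesgue)
      + (\<integral>\<^sup>+x. \<integral>\<^sup>+x'. ?H x' x \<partial>lebesgue \<partial>lebesgue))"
    by (simp add: nn_integral_cmult nn_integral_add)
  also have "\<dots> = ennreal (2 powr p) * (?v m * cell_energy p j u + ?v m * cell_energy p j u)"
    unfolding H1 H2 ..
  also have "\<dots> = ennreal (2 * 2 powr p * grid_vol TYPE('n) m) * cell_energy p j u"
    using grid_vol_pos[of m, where 'n = 'n]
    by (simp add: mult_2[symmetric] ennreal_mult' mult_ac ennreal_numeral[symmetric] del: ennreal_numeral)
  finally show ?thesis .
qed

text \<open>By \<open>cell_energy_refine_le\<close> each of the \<open>m\<close> coarser scales has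
  a weighted oscillation at least comparable to that of scale \<open>m\<close>, while
  \<open>sum_cell_energy_le\<close> bounds their total by the energy. This gains the factor
  \<open>1/m\<close>.\<close>

lemma cell_energy_small:
  fixes u :: "real ^ 'n \<Rightarrow> real"
  assumes u: "u \<in> borel_measurable lebesgue" and p: "0 < p"
  shows "ennreal (real m) * cell_energy p m u
    \<le> ennreal (4 * 2 powr p * real CARD('n) ^ CARD('n) * grid_vol TYPE('n) m) * log_energy p u"
proof -
  let ?N = "real CARD('n) ^ CARD('n)" and ?v = "grid_vol TYPE('n)"
  let ?c = "2 * 2 powr p * ?N * ?v m"
  have v: "0 < ?v k" for k by (rule grid_vol_pos)
  \<comment> \<open>\<open>2^(j*N) * N^N\<close> is the reciprocal volume of a cube of scale
    \<open>j\<close>.\<close>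
  have one: "2 ^ (j * CARD('n)) * (?N * ?v j) = 1" for j
    by (simp add: grid_vol_def power_divide power_mult_distrib power_mult)
  have step: "cell_energy p m u \<le> ennreal ?c * (ennreal (2 ^ (j * CARD('n))) * cell_energy p j u)"
    if "j < m" for j
  proof -
    let ?q = "2 ^ (j * CARD('n)) * ?N :: real"
    have q: "?q * ?v j = 1" using one[of j] by (simp add: mult.assoc)
    have "cell_energy p m u = ennreal ?q * (ennreal (?v j) * cell_energy p m u)"
    proof -
      have "ennreal ?q * ennreal (?v j) = ennreal (?q * ?v j)" by (subst ennreal_mult') auto
      also have "\<dots> = 1" unfolding q by simp
      finally show ?thesis by (simp only: mult.assoc[symmetric] mult_1_left)
    qed
    also have "\<dots> \<le> ennreal ?q * (ennreal (2 * 2 powr p * ?v m) * cell_energy p j u)"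
      using that by (intro mult_left_mono cell_energy_refine_le u p) auto
    also have "\<dots> = ennreal ?c * (ennreal (2 ^ (j * CARD('n))) * cell_energy p j u)"
    proof -
      have "ennreal ?q * ennreal (2 * 2 powr p * ?v m) = ennreal (?q * (2 * 2 powr p * ?v m))"
        by (subst ennreal_mult') auto
      also have "?q * (2 * 2 powr p * ?v m) = ?c * 2 ^ (j * CARD('n))" by simp
      also have "ennreal \<dots> = ennreal ?c * ennreal (2 ^ (j * CARD('n)))"
        using v[of m] by (intro ennreal_mult') auto
      finally show ?thesis by (simp only: mult.assoc[symmetric])
    qed
    finally show ?thesis .
  qed
  have "ennreal (real m) * cell_energy p m u = (\<Sum>j<m. cell_energy p m u)"
    by (simp add: ennreal_of_nat_eq_real_of_nat)
  also have "\<dots> \<le> (\<Sum>j<m. ennreal ?c * (ennreal (2 ^ (j * CARD('n))) * cell_energy p j u))"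
    by (intro sum_mono step) simp
  also have "\<dots> \<le> ennreal ?c * (2 * log_energy p u)"
    unfolding sum_distrib_left[symmetric] by (intro mult_left_mono sum_cell_energy_le u) simp
  also have "\<dots> = ennreal (4 * 2 powr p * ?N * ?v m) * log_energy p u"
  proof -
    have "ennreal ?c * 2 = ennreal (?c * 2)"
      using v[of m] by (subst ennreal_mult'') auto
    also have "?c * 2 = 4 * 2 powr p * ?N * ?v m" by simp
    finally show ?thesis by (simp only: mult.assoc[symmetric])
  qed
  finally show ?thesis .
qed

text \<open>Freezing \<open>u\<close> at a good point of each cube, instead of averaging it, makes Jensen's inequality
  unnecessary.\<close>

lemma exists_le_average:
  assumes Q: "Q \<in> sets M" and v: "emeasure M Q = ennreal v" "0 < v"
    and g [measurable]: "g \<in> borel_measurable M"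
  shows "\<exists>y\<in>Q. ennreal v * g y \<le> (\<integral>\<^sup>+y. g y * indicator Q y \<partial>M)"
proof (rule ccontr)
  note Q [measurable]
  define I where "I = (\<integral>\<^sup>+y. g y * indicator Q y \<partial>M)"
  \<comment> \<open>Were \<open>g\<close> above its average at every point of \<open>Q\<close>,
    integrating over \<open>Q\<close> would yield a number strictly less than itself.\<close>
  assume "\<not> ?thesis"
  then have less: "I < ennreal v * g y" if "y \<in> Q" for y
    using that by (auto simp: I_def not_le)
  have "Q \<noteq> {}" using v by auto
  then have I: "I \<noteq> \<infinity>" using less by fastforce
  have "(\<integral>\<^sup>+y. I * indicator Q y \<partial>M) < (\<integral>\<^sup>+y. ennreal v * (g y * indicator Q y) \<partial>M)"
  proof (rule nn_integral_less)
    show "(\<integral>\<^sup>+y. I * indicator Q y \<partial>M) \<noteq> \<infinity>"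
      using I v by (simp add: nn_integral_cmult_indicator ennreal_mult_eq_top_iff)
    show "AE y in M. I * indicator Q y \<le> ennreal v * (g y * indicator Q y)"
      using less by (intro AE_I2) (auto split: split_indicator intro: less_imp_le)
    show "\<not> (AE y in M. ennreal v * (g y * indicator Q y) \<le> I * indicator Q y)"
    proof
      assume "AE y in M. ennreal v * (g y * indicator Q y) \<le> I * indicator Q y"
      then have "AE y in M. y \<notin> Q"
        by eventually_elim (use less in \<open>auto simp: not_le[symmetric] split: split_indicator_asm\<close>)
      then have "emeasure M Q = 0"
        using Q by (simp add: AE_iff_null_sets null_setsD1)
      then show False using v by simp
    qed
  qed measurable
  also have "\<dots> = ennreal v * I" by (simp add: nn_integral_cmult I_def)
  also have "\<dots> = (\<integral>\<^sup>+y. I * indicator Q y \<partial>M)"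
    using v by (simp add: nn_integral_cmult_indicator Q mult.commute)
  finally show False by simp
qed

text \<open>The constant of a cube is the value of \<open>u\<close> at a point supplied by
  \<open>exists_le_average\<close>. Summed over the cubes, the averaged integrals run over pairs in
  a common cube, which is what \<open>cell_energy\<close> measures.\<close>

lemma cell_constants:
  fixes u :: "real ^ 'n \<Rightarrow> real"
  assumes [measurable]: "u \<in> borel_measurable lebesgue" and F: "finite F"
  obtains c where "ennreal (grid_vol TYPE('n) j) *
      (\<Sum>a\<in>F. \<integral>\<^sup>+x. ennreal (\<bar>u x - c a\<bar> powr p) * indicator {x. grid j x = a} x \<partial>lebesgue)
    \<le> cell_energy p j u"
proof -
  let ?v = "ennreal (grid_vol TYPE('n) j)"
  let ?g = "\<lambda>a y. \<integral>\<^sup>+x. ennreal (\<bar>u x - u y\<bar> powr p) * indicator {x. grid j x = a} x \<partial>lebesgue"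
  have ex: "\<exists>y. ?v * ?g a y \<le> (\<integral>\<^sup>+y. ?g a y * indicator {y. grid j y = a} y \<partial>lebesgue)" for a
  proof -
    have "?g a \<in> borel_measurable lebesgue" by measurable
    from exists_le_average[OF sets_grid_cell emeasure_grid_cell[of j a] grid_vol_pos this]
    show ?thesis by (elim bexE) (rule exI)
  qed
  have "\<exists>y. \<forall>a. ?v * ?g a (y a) \<le> (\<integral>\<^sup>+y. ?g a y * indicator {y. grid j y = a} y \<partial>lebesgue)"
    by (intro choice allI ex)
  then obtain y where y: "\<forall>a. ?v * ?g a (y a) \<le> (\<integral>\<^sup>+y. ?g a y * indicator {y. grid j y = a} y \<partial>lebesgue)" ..
  have "?v * (\<Sum>a\<in>F. ?g a (y a)) \<le> (\<Sum>a\<in>F. \<integral>\<^sup>+y. ?g a y * indicator {y. grid j y = a} y \<partial>lebesgue)"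
    unfolding sum_distrib_left by (intro sum_mono y[rule_format])
  also have "\<dots> = (\<integral>\<^sup>+y. \<integral>\<^sup>+x. (\<Sum>a\<in>F. ennreal (\<bar>u x - u y\<bar> powr p) * indicator {x. grid j x = a} x
      * indicator {y. grid j y = a} y) \<partial>lebesgue \<partial>lebesgue)"
    by (simp add: nn_integral_sum nn_integral_multc)
  also have "\<dots> \<le> cell_energy p j u"
    unfolding cell_energy_def
  proof (intro nn_integral_mono)
    fix y x
    have "(\<Sum>a\<in>F. ennreal (\<bar>u x - u y\<bar> powr p) * indicator {x. grid j x = a} x * indicator {y. grid j y = a} y)
      = (\<Sum>a\<in>F. if grid j y = a then (if grid j y = grid j x then ennreal (\<bar>u y - u x\<bar> powr p) else 0) else 0)"
      by (intro sum.cong) (auto split: split_indicator simp: abs_minus_commute)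
    also have "\<dots> \<le> (if grid j y = grid j x then ennreal (\<bar>u y - u x\<bar> powr p) else 0)"
      using F by simp
    finally show "(\<Sum>a\<in>F. ennreal (\<bar>u x - u y\<bar> powr p) * indicator {x. grid j x = a} x * indicator {y. grid j y = a} y)
      \<le> (if grid j y = grid j x then ennreal (\<bar>u y - u x\<bar> powr p) else 0)" .
  qed
  finally show ?thesis by (rule that)
qed

text \<open>The cell volumes in \<open>cell_constants\<close> and \<open>cell_energy_small\<close>
  cancel. What remains is an error of order \<open>1/m\<close>, uniform over all \<open>u\<close>
  with energy at most \<open>B\<close>.\<close>

lemma step_approximation:
  fixes u :: "real ^ 'n \<Rightarrow> real"
  assumes p: "0 < p" and F: "finite F" and m: "0 < m"
    and u: "u \<in> borel_measurable lebesgue" and E: "log_energy p u \<le> ennreal B"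
  obtains c where "(\<Sum>a\<in>F. \<integral>\<^sup>+x. ennreal (\<bar>u x - c a\<bar> powr p) * indicator {x. grid m x = a} x \<partial>lebesgue)
    \<le> ennreal (4 * 2 powr p * real CARD('n) ^ CARD('n) * B / real m)"
proof -
  let ?N = "real CARD('n) ^ CARD('n)" and ?v = "grid_vol TYPE('n) m"
  obtain c where c: "ennreal ?v *
      (\<Sum>a\<in>F. \<integral>\<^sup>+x. ennreal (\<bar>u x - c a\<bar> powr p) * indicator {x. grid m x = a} x \<partial>lebesgue)
    \<le> cell_energy p m u"
    using cell_constants[OF u F] by blast
  let ?S = "\<Sum>a\<in>F. \<integral>\<^sup>+x. ennreal (\<bar>u x - c a\<bar> powr p) * indicator {x. grid m x = a} x \<partial>lebesgue"
  have v: "0 < ?v" by (rule grid_vol_pos)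
  have "ennreal (real m * ?v) * ?S \<le> ennreal (real m) * cell_energy p m u"
    using c v by (simp add: ennreal_mult' mult.assoc mult_left_mono)
  also have "\<dots> \<le> ennreal (4 * 2 powr p * ?N * ?v) * ennreal B"
    using cell_energy_small[OF u p, of m] by (rule order_trans) (intro mult_left_mono E; simp)
  finally have *: "ennreal (real m * ?v) * ?S \<le> ennreal (4 * 2 powr p * ?N * ?v * B)"
    using v by (simp add: ennreal_mult'[symmetric])
  have q: "1 / (real m * ?v) * (real m * ?v) = 1" using v m by simp
  have "?S = ennreal (1 / (real m * ?v)) * (ennreal (real m * ?v) * ?S)"
  proof -
    have "ennreal (1 / (real m * ?v)) * ennreal (real m * ?v) = ennreal (1 / (real m * ?v) * (real m * ?v))"
      using v by (subst ennreal_mult') auto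
    also have "\<dots> = 1" unfolding q by simp
    finally show ?thesis by (simp only: mult.assoc[symmetric] mult_1_left)
  qed
  also have "\<dots> \<le> ennreal (1 / (real m * ?v)) * ennreal (4 * 2 powr p * ?N * ?v * B)"
    by (intro mult_left_mono *) simp
  also have "\<dots> = ennreal (4 * 2 powr p * ?N * B / real m)"
    using v m by (simp add: ennreal_mult'[symmetric] mult.assoc)
  finally show ?thesis by (rule that)
qed

section \<open>Compactness in \<open>L\<^sup>p\<close>\<close>

lemma powr_add3_le:
  fixes a b c p :: real
  assumes "0 < p"
  shows "\<bar>a + b + c\<bar> powr p \<le> 2 powr p * 2 powr p * (\<bar>a\<bar> powr p + \<bar>b\<bar> powr p + \<bar>c\<bar> powr p)"
proof -
  have P: "1 \<le> 2 powr p" using assms by (intro ge_one_powr_ge_zero) auto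
  have "\<bar>a + b + c\<bar> powr p \<le> 2 powr p * (\<bar>a + b\<bar> powr p + \<bar>c\<bar> powr p)"
    by (rule powr_add_le[OF assms])
  also have "\<dots> \<le> 2 powr p * (2 powr p * (\<bar>a\<bar> powr p + \<bar>b\<bar> powr p) + 2 powr p * \<bar>c\<bar> powr p)"
    using P by (intro mult_left_mono add_mono powr_add_le assms) (auto simp: mult_le_cancel_right1)
  also have "\<dots> = 2 powr p * 2 powr p * (\<bar>a\<bar> powr p + \<bar>b\<bar> powr p + \<bar>c\<bar> powr p)"
    by (simp add: algebra_simps)
  finally show ?thesis .
qed

lemma nn_integral_grid_split:
  fixes f :: "real ^ 'n \<Rightarrow> ennreal"
  assumes [measurable]: "f \<in> borel_measurable lebesgue" and F: "finite F" "\<And>x. grid j x \<notin> F \<Longrightarrow> f x = 0"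
  shows "(\<integral>\<^sup>+x. f x \<partial>lebesgue) = (\<Sum>a\<in>F. \<integral>\<^sup>+x. f x * indicator {x. grid j x = a} x \<partial>lebesgue)"
proof -
  have "f x = (\<Sum>a\<in>F. f x * indicator {x. grid j x = a} x)" for x
  proof -
    have "(\<Sum>a\<in>F. f x * indicator {x. grid j x = a} x) = (\<Sum>a\<in>F. if grid j x = a then f x else 0)"
      by (intro sum.cong) (auto split: split_indicator)
    also have "\<dots> = f x" using F by simp
    finally show ?thesis by simp
  qed
  then have "(\<integral>\<^sup>+x. f x \<partial>lebesgue) = (\<integral>\<^sup>+x. (\<Sum>a\<in>F. f x * indicator {x. grid j x = a} x) \<partial>lebesgue)"
    by (intro nn_integral_cong)
  also have "\<dots> = (\<Sum>a\<in>F. \<integral>\<^sup>+x. f x * indicator {x. grid j x = a} x \<partial>lebesgue)"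
    by (rule nn_integral_sum) measurable
  finally show ?thesis .
qed

text \<open>On the cube, \<open>|c|\<close> is at most \<open>|u| + |u - c|\<close>; integrating
  \<open>p\<close>-th powers bounds the constant uniformly in \<open>u\<close> at each fixed scale.
  This boundedness allows convergent constants to be extracted.\<close>

lemma cell_constant_bounded:
  fixes u :: "real ^ 'n \<Rightarrow> real"
  assumes [measurable]: "u \<in> borel_measurable lebesgue" and p: "0 < p" and nn: "0 \<le> B" "0 \<le> \<eta>"
    and Lp: "(\<integral>\<^sup>+x. ennreal (\<bar>u x\<bar> powr p) \<partial>lebesgue) \<le> ennreal B"
    and c: "(\<integral>\<^sup>+x. ennreal (\<bar>u x - c\<bar> powr p) * indicator {x. grid j x = a} x \<partial>lebesgue) \<le> ennreal \<eta>"
  shows "\<bar>c\<bar> \<le> (2 powr p * (B + \<eta>) / grid_vol TYPE('n) j) powr (1 / p)"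
proof -
  let ?v = "grid_vol TYPE('n) j" and ?Q = "{x. grid j x = a}"
  have v: "0 < ?v" by (rule grid_vol_pos)
  have "ennreal (\<bar>c\<bar> powr p * ?v) = (\<integral>\<^sup>+x. ennreal (\<bar>c\<bar> powr p) * indicator ?Q x \<partial>lebesgue)"
    by (simp only: nn_integral_cmult_indicator sets_grid_cell emeasure_grid_cell) (simp add: ennreal_mult')
  also have "\<dots> \<le> (\<integral>\<^sup>+x. ennreal (2 powr p) * (ennreal (\<bar>u x\<bar> powr p) + ennreal (\<bar>u x - c\<bar> powr p) * indicator ?Q x) \<partial>lebesgue)"
  proof (intro nn_integral_mono)
    fix x
    have "ennreal (\<bar>c\<bar> powr p) \<le> ennreal (2 powr p) * (ennreal (\<bar>u x\<bar> powr p) + ennreal (\<bar>u x - c\<bar> powr p))"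
      using ennreal_powr_add_le[OF p, of "u x" "c - u x"] by (simp add: abs_minus_commute)
    then show "ennreal (\<bar>c\<bar> powr p) * indicator ?Q x
      \<le> ennreal (2 powr p) * (ennreal (\<bar>u x\<bar> powr p) + ennreal (\<bar>u x - c\<bar> powr p) * indicator ?Q x)"
      by (auto split: split_indicator)
  qed
  also have "\<dots> = ennreal (2 powr p) * ((\<integral>\<^sup>+x. ennreal (\<bar>u x\<bar> powr p) \<partial>lebesgue)
      + (\<integral>\<^sup>+x. ennreal (\<bar>u x - c\<bar> powr p) * indicator ?Q x \<partial>lebesgue))"
    by (simp add: nn_integral_cmult nn_integral_add)
  also have "\<dots> \<le> ennreal (2 powr p) * (ennreal B + ennreal \<eta>)"
    by (intro mult_left_mono add_mono Lp c) simp
  also have "\<dots> = ennreal (2 powr p * (B + \<eta>))"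
    using nn by (simp add: ennreal_mult')
  finally have "\<bar>c\<bar> powr p * ?v \<le> 2 powr p * (B + \<eta>)"
    using nn by simp
  then have "\<bar>c\<bar> powr p \<le> 2 powr p * (B + \<eta>) / ?v"
    using v by (simp add: pos_le_divide_eq)
  then have "(\<bar>c\<bar> powr p) powr (1 / p) \<le> (2 powr p * (B + \<eta>) / ?v) powr (1 / p)"
    using p by (intro powr_mono2) auto
  then show ?thesis using p by (simp add: powr_powr)
qed

text \<open>On each cube \<open>u - w\<close> splits into two approximation errors and the
  difference of the two constants. The last part costs the number of cubes times their
  volume.\<close>

lemma step_approximation_diff:
  fixes u w :: "real ^ 'n \<Rightarrow> real"
  assumes [measurable]: "u \<in> borel_measurable lebesgue" "w \<in> borel_measurable lebesgue"
    and p: "0 < p" and F: "finite F" and z: "\<And>x. grid j x \<notin> F \<Longrightarrow> u x = 0 \<and> w x = 0" and nn: "0 \<le> \<eta>" "0 \<le> \<delta>"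
    and u: "(\<Sum>a\<in>F. \<integral>\<^sup>+x. ennreal (\<bar>u x - c a\<bar> powr p) * indicator {x. grid j x = a} x \<partial>lebesgue) \<le> ennreal \<eta>"
    and w: "(\<Sum>a\<in>F. \<integral>\<^sup>+x. ennreal (\<bar>w x - d a\<bar> powr p) * indicator {x. grid j x = a} x \<partial>lebesgue) \<le> ennreal \<eta>"
    and cd: "\<And>a. a \<in> F \<Longrightarrow> \<bar>c a - d a\<bar> powr p \<le> \<delta>"
  shows "(\<integral>\<^sup>+x. ennreal (\<bar>u x - w x\<bar> powr p) \<partial>lebesgue)
    \<le> ennreal (2 powr p * 2 powr p * (2 * \<eta> + real (card F) * (\<delta> * grid_vol TYPE('n) j)))"
proof -
  let ?v = "grid_vol TYPE('n) j" and ?Q = "\<lambda>a. {x. grid j x = a}" and ?P = "2 powr p * 2 powr p :: real"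
  have v: "0 < ?v" by (rule grid_vol_pos)
  have "(\<integral>\<^sup>+x. ennreal (\<bar>u x - w x\<bar> powr p) \<partial>lebesgue)
    = (\<Sum>a\<in>F. \<integral>\<^sup>+x. ennreal (\<bar>u x - w x\<bar> powr p) * indicator (?Q a) x \<partial>lebesgue)"
    by (intro nn_integral_grid_split F) (auto dest: z)
  also have "\<dots> \<le> (\<Sum>a\<in>F. \<integral>\<^sup>+x. ennreal ?P * (ennreal (\<bar>u x - c a\<bar> powr p) * indicator (?Q a) x
      + ennreal (\<bar>w x - d a\<bar> powr p) * indicator (?Q a) x + ennreal \<delta> * indicator (?Q a) x) \<partial>lebesgue)"
  proof (intro sum_mono nn_integral_mono)
    fix a x assume a: "a \<in> F"
    have "\<bar>u x - w x\<bar> powr p \<le> ?P * (\<bar>u x - c a\<bar> powr p + \<bar>w x - d a\<bar> powr p + \<bar>c a - d a\<bar> powr p)"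
      using powr_add3_le[OF p, of "u x - c a" "d a - w x" "c a - d a"] by (simp add: abs_minus_commute)
    also have "\<dots> \<le> ?P * (\<bar>u x - c a\<bar> powr p + \<bar>w x - d a\<bar> powr p + \<delta>)"
      using cd[OF a] by (intro mult_left_mono add_left_mono) auto
    finally have "ennreal (\<bar>u x - w x\<bar> powr p)
      \<le> ennreal ?P * (ennreal (\<bar>u x - c a\<bar> powr p) + ennreal (\<bar>w x - d a\<bar> powr p) + ennreal \<delta>)"
      using nn by (simp add: ennreal_mult'[symmetric] ennreal_plus[symmetric] del: ennreal_plus)
    then show "ennreal (\<bar>u x - w x\<bar> powr p) * indicator (?Q a) x
      \<le> ennreal ?P * (ennreal (\<bar>u x - c a\<bar> powr p) * indicator (?Q a) x
        + ennreal (\<bar>w x - d a\<bar> powr p) * indicator (?Q a) x + ennreal \<delta> * indicator (?Q a) x)"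
      by (auto split: split_indicator)
  qed
  also have "\<dots> = (\<Sum>a\<in>F. ennreal ?P * ((\<integral>\<^sup>+x. ennreal (\<bar>u x - c a\<bar> powr p) * indicator (?Q a) x \<partial>lebesgue)
      + (\<integral>\<^sup>+x. ennreal (\<bar>w x - d a\<bar> powr p) * indicator (?Q a) x \<partial>lebesgue) + ennreal \<delta> * ennreal ?v))"
    by (simp add: nn_integral_cmult nn_integral_add emeasure_grid_cell del: emeasure_completion)
  also have "\<dots> = ennreal ?P * ((\<Sum>a\<in>F. \<integral>\<^sup>+x. ennreal (\<bar>u x - c a\<bar> powr p) * indicator (?Q a) x \<partial>lebesgue)
      + (\<Sum>a\<in>F. \<integral>\<^sup>+x. ennreal (\<bar>w x - d a\<bar> powr p) * indicator (?Q a) x \<partial>lebesgue)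
      + (\<Sum>a\<in>F. ennreal \<delta> * ennreal ?v))"
    by (simp only: sum.distrib sum_distrib_left distrib_left)
  also have "\<dots> \<le> ennreal ?P * (ennreal \<eta> + ennreal \<eta> + (\<Sum>a\<in>F. ennreal \<delta> * ennreal ?v))"
    by (intro mult_left_mono add_mono u w) auto
  also have "(\<Sum>a\<in>F. ennreal \<delta> * ennreal ?v) = ennreal (real (card F) * (\<delta> * ?v))"
    using nn by (simp add: ennreal_mult'[symmetric] ennreal_of_nat_eq_real_of_nat)
  also have "ennreal ?P * (ennreal \<eta> + ennreal \<eta> + ennreal (real (card F) * (\<delta> * ?v)))
    = ennreal (?P * (2 * \<eta> + real (card F) * (\<delta> * ?v)))"
    using nn v by (simp add: ennreal_mult'[symmetric] ennreal_plus[symmetric] del: ennreal_plus)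
  finally show ?thesis .
qed

text \<open>At every scale each function is approximated through finitely many constants, bounded
  per scale. A diagonal subsequence makes all of them converge, and at a scale with small
  approximation error the functions inherit the Cauchy property.\<close>

lemma Lp_Cauchy_subsequence:
  fixes u :: "nat \<Rightarrow> real ^ 'n \<Rightarrow> real"
  assumes p: "0 < p" and \<Omega>: "bounded \<Omega>" and B: "0 \<le> B\<^sub>1" "0 \<le> B\<^sub>2"
    and u: "\<And>k. u k \<in> borel_measurable lebesgue" and z: "\<And>k x. x \<notin> \<Omega> \<Longrightarrow> u k x = 0"
    and Lp: "\<And>k. (\<integral>\<^sup>+x. ennreal (\<bar>u k x\<bar> powr p) \<partial>lebesgue) \<le> ennreal B\<^sub>1"
    and E: "\<And>k. log_energy p (u k) \<le> ennreal B\<^sub>2"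
  obtains r :: "nat \<Rightarrow> nat" where "strict_mono r"
    "\<And>e. 0 < e \<Longrightarrow> \<exists>K. \<forall>k\<ge>K. \<forall>l\<ge>K. (\<integral>\<^sup>+x. ennreal (\<bar>u (r k) x - u (r l) x\<bar> powr p) \<partial>lebesgue) \<le> ennreal e"
proof -
  let ?Q = "\<lambda>m a. {x. grid (Suc m) x = a}" and ?v = "\<lambda>m. grid_vol TYPE('n) (Suc m)"
  \<comment> \<open>\<open>Suc m\<close> keeps the scale positive, as
    \<open>step_approximation\<close> requires.\<close>
  define F where "F = (\<lambda>m. grid (Suc m) ` \<Omega>)"
  define q where "q = 4 * 2 powr p * real CARD('n) ^ CARD('n) * B\<^sub>2"
  define \<eta> where "\<eta> = (\<lambda>m. q / real (Suc m))"
  have q: "0 \<le> q" using B by (simp add: q_def)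
  have \<eta>: "0 \<le> \<eta> m" for m using q by (simp add: \<eta>_def)
  have v: "0 < ?v m" for m by (rule grid_vol_pos)
  have F: "finite (F m)" for m unfolding F_def by (rule finite_grid_image[OF \<Omega>])
  let ?S = "\<lambda>k m c. \<Sum>a\<in>F m. \<integral>\<^sup>+x. ennreal (\<bar>u k x - c a\<bar> powr p) * indicator (?Q m a) x \<partial>lebesgue"
  have ex: "\<exists>c. ?S k m c \<le> ennreal (\<eta> m)" for k m
    unfolding \<eta>_def q_def by (rule step_approximation[OF p F zero_less_Suc u E]) (rule exI)
  have "\<exists>c. \<forall>k. \<forall>m. ?S k m (c k m) \<le> ennreal (\<eta> m)"
    by (intro choice allI ex)
  then obtain c where c: "\<forall>k. \<forall>m. ?S k m (c k m) \<le> ennreal (\<eta> m)" ..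
  define R where "R = (\<lambda>m. (2 powr p * (B\<^sub>1 + \<eta> m) / ?v m) powr (1 / p))"
  have R: "0 \<le> R m" for m by (simp add: R_def)
  have bd: "\<bar>c k m a\<bar> \<le> R m" if "a \<in> F m" for k m a
    unfolding R_def
  proof (rule cell_constant_bounded[OF u p B(1) \<eta> Lp])
    have "(\<integral>\<^sup>+x. ennreal (\<bar>u k x - c k m a\<bar> powr p) * indicator (?Q m a) x \<partial>lebesgue) \<le> ?S k m (c k m)"
      using that F by (intro member_le_sum) auto
    also have "\<dots> \<le> ennreal (\<eta> m)" using c by simp
    finally show "(\<integral>\<^sup>+x. ennreal (\<bar>u k x - c k m a\<bar> powr p) * indicator (?Q m a) x \<partial>lebesgue) \<le> ennreal (\<eta> m)" .
  qed
  \<comment> \<open>The diagonal extraction runs over the countable set of pairs of scale and cube.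
    It asks for one common bound, so the constants are divided by the positive number
    \<open>R m + 1\<close>.\<close>
  obtain r :: "nat \<Rightarrow> nat" where r: "strict_mono r"
    and conv: "\<And>z. z \<in> (SIGMA m:UNIV. F m) \<Longrightarrow> \<exists>l. (\<lambda>k. (case z of (m, a) \<Rightarrow> c (r k) m a / (R m + 1))) \<longlonglongrightarrow> l"
  proof (rule function_convergent_subsequence[of "SIGMA m:UNIV. F m" "\<lambda>k (m, a). c k m a / (R m + 1)" 1])
    show "countable (SIGMA m:UNIV. F m)" by (rule countableI_type)
    fix k z assume "z \<in> (SIGMA m:UNIV. F m)"
    then obtain m a where ma: "z = (m, a)" "a \<in> F m" by auto
    have "0 < R m + 1" using R[of m] by linarith
    moreover have "\<bar>c k m a\<bar> \<le> R m + 1" using bd[OF ma(2), of k] by linarith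
    ultimately show "norm (case z of (m, a) \<Rightarrow> c k m a / (R m + 1)) \<le> 1"
      using ma by (simp add: pos_divide_le_eq)
  qed (rule that)
  have conv': "\<exists>l. (\<lambda>k. c (r k) m a) \<longlonglongrightarrow> l" if a: "a \<in> F m" for m a
  proof -
    obtain l where "(\<lambda>k. c (r k) m a / (R m + 1)) \<longlonglongrightarrow> l" using conv[of "(m, a)"] a by auto
    then have "(\<lambda>k. c (r k) m a / (R m + 1) * (R m + 1)) \<longlonglongrightarrow> l * (R m + 1)" by (intro tendsto_intros)
    moreover have "R m + 1 \<noteq> 0" using R[of m] by linarith
    ultimately show ?thesis by auto
  qed
  show ?thesis
  proof (rule that[OF r])
    fix e :: real assume e: "0 < e"
    let ?P = "2 powr p * 2 powr p :: real"
    have P: "0 < ?P" by simp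
    \<comment> \<open>One half of \<open>e\<close> pays for the approximation errors, the other for
      the differences of the constants.\<close>
    obtain m :: nat where m: "4 * ?P * q / e < real m" using reals_Archimedean2 by blast
    then have "4 * ?P * q / e < real (Suc m)" by simp
    then have "4 * ?P * q < e * real (Suc m)"
      using e by (subst (asm) pos_divide_less_eq) (auto simp: mult.commute)
    then have m: "?P * (2 * \<eta> m) \<le> e / 2"
      unfolding \<eta>_def by (simp add: field_simps)
    \<comment> \<open>The added 1 keeps the denominator positive when \<open>F m\<close> is
      empty.\<close>
    define \<delta> where "\<delta> = e / (2 * ?P * (real (card (F m)) + 1) * ?v m)"
    have den: "0 < 2 * ?P * (real (card (F m)) + 1) * ?v m"
      using v[of m] by (intro mult_pos_pos) auto
    have \<delta>: "0 < \<delta>" using e den unfolding \<delta>_def by (rule divide_pos_pos)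
    have \<delta>2: "?P * (real (card (F m)) * (\<delta> * ?v m)) \<le> e / 2"
    proof -
      have "\<delta> * (2 * ?P * (real (card (F m)) + 1) * ?v m) = e"
        by (simp only: \<delta>_def times_divide_eq_left nonzero_mult_div_cancel_right[OF less_imp_neq[OF den, symmetric]])
      then have "?P * ((real (card (F m)) + 1) * (\<delta> * ?v m)) = e / 2" by (simp add: field_simps)
      moreover have "?P * (real (card (F m)) * (\<delta> * ?v m)) \<le> ?P * ((real (card (F m)) + 1) * (\<delta> * ?v m))"
        using \<delta> v[of m] by (intro mult_left_mono mult_right_mono) auto
      ultimately show ?thesis by linarith
    qed
    define \<rho> where "\<rho> = \<delta> powr (1 / p)"
    have \<rho>: "0 < \<rho>" "\<rho> powr p = \<delta>" using \<delta> p by (simp_all add: \<rho>_def powr_powr)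
    have "\<forall>a\<in>F m. \<exists>l. (\<lambda>k. c (r k) m a) \<longlonglongrightarrow> l" using conv' by simp
    then obtain L where L: "\<forall>a\<in>F m. (\<lambda>k. c (r k) m a) \<longlonglongrightarrow> L a" by (rule bchoice[THEN exE])
    have "\<forall>\<^sub>F k in sequentially. \<forall>a\<in>F m. dist (c (r k) m a) (L a) < \<rho> / 2"
      using L \<rho> by (intro eventually_ball_finite F ballI tendstoD) auto
    then obtain K where K: "\<And>k a. K \<le> k \<Longrightarrow> a \<in> F m \<Longrightarrow> dist (c (r k) m a) (L a) < \<rho> / 2"
      by (auto simp: eventually_sequentially)
    show "\<exists>K. \<forall>k\<ge>K. \<forall>l\<ge>K. (\<integral>\<^sup>+x. ennreal (\<bar>u (r k) x - u (r l) x\<bar> powr p) \<partial>lebesgue) \<le> ennreal e"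
    proof (intro exI[of _ K] allI impI)
      fix k l assume k: "K \<le> k" and l: "K \<le> l"
      have "(\<integral>\<^sup>+x. ennreal (\<bar>u (r k) x - u (r l) x\<bar> powr p) \<partial>lebesgue)
        \<le> ennreal (?P * (2 * \<eta> m + real (card (F m)) * (\<delta> * ?v m)))"
      proof (rule step_approximation_diff[OF u u p F])
        show "u (r k) x = 0 \<and> u (r l) x = 0" if "grid (Suc m) x \<notin> F m" for x
          using that z by (auto simp: F_def)
        show "\<bar>c (r k) m a - c (r l) m a\<bar> powr p \<le> \<delta>" if "a \<in> F m" for a
        proof -
          have "dist (c (r k) m a) (c (r l) m a) < \<rho>"
            using K[OF k that] K[OF l that] by (rule dist_triangle_half_l)
          then have "\<bar>c (r k) m a - c (r l) m a\<bar> powr p \<le> \<rho> powr p"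
            using p by (intro powr_mono2) (auto simp: dist_real_def)
          then show ?thesis using \<rho> by simp
        qed
      qed (use c \<eta> \<delta> in auto)
      also have "\<dots> \<le> ennreal e"
        using m \<delta>2 by (intro ennreal_leI) (simp only: distrib_left; linarith)
      finally show "(\<integral>\<^sup>+x. ennreal (\<bar>u (r k) x - u (r l) x\<bar> powr p) \<partial>lebesgue) \<le> ennreal e" .
    qed
  qed
qed

section \<open>Subcritical growth\<close>

text \<open>A finite sum bounds each of its terms, and the weight turns this bound into
  \<open>|f (Suc n) - f n| <= const * 2^-n\<close>. The increments are therefore absolutely
  summable.\<close>

lemma convergent_of_powr_weighted_finite:
  fixes f :: "nat \<Rightarrow> real"
  assumes p: "0 < p" and S: "(\<Sum>n. ennreal (2 powr (p * real n) * \<bar>f (Suc n) - f n\<bar> powr p)) \<noteq> \<infinity>"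
  shows "convergent f"
proof -
  let ?g = "\<lambda>n. 2 powr (p * real n) * \<bar>f (Suc n) - f n\<bar> powr p"
  define G where "G = (\<Sum>n. ennreal (?g n))"
  have "G \<noteq> \<infinity>" using S unfolding G_def .
  then obtain T where T: "G = ennreal T" "0 \<le> T" by (cases G) auto
  have le: "norm (f (Suc n) - f n) \<le> T powr (1 / p) * (1 / 2) ^ n" for n
  proof -
    have "(\<Sum>i\<in>{n}. ennreal (?g i)) \<le> G"
      unfolding G_def by (intro sum_le_suminf summableI) auto
    then have "ennreal (?g n) \<le> G" by simp
    then have "?g n \<le> T" using T by simp
    then have "(?g n) powr (1 / p) \<le> T powr (1 / p)"
      using p by (intro powr_mono2) auto
    moreover have "(2 powr (p * real n)) powr (1 / p) = 2 ^ n"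
      unfolding powr_powr using p by (simp add: powr_realpow)
    moreover have "(\<bar>f (Suc n) - f n\<bar> powr p) powr (1 / p) = \<bar>f (Suc n) - f n\<bar>"
      unfolding powr_powr using p by simp
    ultimately have "2 ^ n * \<bar>f (Suc n) - f n\<bar> \<le> T powr (1 / p)"
      by (simp only: powr_mult powr_ge_zero abs_ge_zero)
    then show ?thesis by (simp add: power_one_over pos_le_divide_eq mult.commute)
  qed
  have "summable (\<lambda>n. f (Suc n) - f n)"
  proof (rule summable_comparison_test')
    show "summable (\<lambda>n. T powr (1 / p) * (1 / 2) ^ n)"
      by (intro summable_mult summable_geometric) simp
    show "norm (f (Suc n) - f n) \<le> T powr (1 / p) * (1 / 2) ^ n" if "0 \<le> n" for n
      by (rule le)
  qed
  then have "convergent (\<lambda>m. \<Sum>n<m. f (Suc n) - f n)"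
    by (simp only: summable_iff_convergent)
  then have "convergent (\<lambda>n. f n - f 0)"
    by (simp only: sum_lessThan_telescope)
  from convergent_add[OF this convergent_const[of "f 0"]] show ?thesis
    by simp
qed

text \<open>The subsequence step of the Riesz-Fischer theorem, with weights in place of Minkowski's
  inequality: the weighted sum of the increments has finite integral, so it is finite almost
  everywhere.\<close>

lemma Lp_Cauchy_AE_subsequence:
  fixes f :: "nat \<Rightarrow> 'a \<Rightarrow> real"
  assumes p: "0 < p" and [measurable]: "\<And>k. f k \<in> borel_measurable M"
    and C: "\<And>e. 0 < e \<Longrightarrow> \<exists>K. \<forall>k\<ge>K. \<forall>l\<ge>K. (\<integral>\<^sup>+x. ennreal (\<bar>f k x - f l x\<bar> powr p) \<partial>M) \<le> ennreal e"
  obtains s :: "nat \<Rightarrow> nat" where "strict_mono s" "AE x in M. convergent (\<lambda>k. f (s k) x)"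
proof -
  \<comment> \<open>Chosen so that the weighted increment with index \<open>n\<close> has integral
    at most \<open>(1/2)^n\<close>.\<close>
  define e where "e = (\<lambda>n. (1/2) ^ n / 2 powr (p * real n) :: real)"
  have "\<exists>K. \<forall>n. \<forall>k\<ge>K n. \<forall>l\<ge>K n. (\<integral>\<^sup>+x. ennreal (\<bar>f k x - f l x\<bar> powr p) \<partial>M) \<le> ennreal (e n)"
    by (intro choice allI C) (simp add: e_def)
  then obtain K where K: "\<forall>n. \<forall>k\<ge>K n. \<forall>l\<ge>K n. (\<integral>\<^sup>+x. ennreal (\<bar>f k x - f l x\<bar> powr p) \<partial>M) \<le> ennreal (e n)" ..
  define s where "s = rec_nat (K 0) (\<lambda>n a. max (Suc a) (K (Suc n)))"
  have s_Suc: "s (Suc n) = max (Suc (s n)) (K (Suc n))" for n by (simp add: s_def)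
  have sK: "K n \<le> s n" for n by (cases n) (simp_all add: s_def)
  have s: "strict_mono s" by (rule strict_monoI_Suc) (simp add: s_Suc)
  let ?g = "\<lambda>n x. ennreal (2 powr (p * real n) * \<bar>f (s (Suc n)) x - f (s n) x\<bar> powr p)"
  have "(\<integral>\<^sup>+x. (\<Sum>n. ?g n x) \<partial>M) = (\<Sum>n. \<integral>\<^sup>+x. ?g n x \<partial>M)"
    by (rule nn_integral_suminf) measurable
  also have "\<dots> \<le> (\<Sum>n. ennreal ((1/2) ^ n))"
  proof (intro suminf_le summableI)
    fix n
    have "K n \<le> s (Suc n)" using sK[of n] by (simp add: s_Suc)
    then have "(\<integral>\<^sup>+x. ennreal (\<bar>f (s (Suc n)) x - f (s n) x\<bar> powr p) \<partial>M) \<le> ennreal (e n)"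
      using K sK by simp
    then have "(\<integral>\<^sup>+x. ?g n x \<partial>M) \<le> ennreal (2 powr (p * real n)) * ennreal (e n)"
      by (simp add: ennreal_mult' nn_integral_cmult mult_left_mono)
    also have "\<dots> = ennreal ((1/2) ^ n)"
      by (simp add: e_def ennreal_mult'[symmetric])
    finally show "(\<integral>\<^sup>+x. ?g n x \<partial>M) \<le> ennreal ((1/2) ^ n)" .
  qed
  also have "\<dots> = ennreal (\<Sum>n. (1/2) ^ n)"
    by (intro suminf_ennreal2) (auto intro: summable_geometric)
  finally have "(\<integral>\<^sup>+x. (\<Sum>n. ?g n x) \<partial>M) \<noteq> \<infinity>"
    by (auto simp: top_unique)
  then have "AE x in M. (\<Sum>n. ?g n x) \<noteq> \<infinity>"
    by (intro nn_integral_PInf_AE) measurable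
  then have "AE x in M. convergent (\<lambda>k. f (s k) x)"
    by eventually_elim (rule convergent_of_powr_weighted_finite[OF p])
  with s show ?thesis by (rule that)
qed

section \<open>Logarithmic majorants and their limits\<close>

text \<open>The majorant that stands in for \<open>\<psi>\<close> in all limits. For positive
  \<open>p\<close> it is even and continuous in \<open>t\<close>, which is what the use of Fatou's
  lemma rests on.\<close>

definition log_growth :: "real \<Rightarrow> real \<Rightarrow> real \<Rightarrow> real \<Rightarrow> real" where
  "log_growth p \<epsilon> C t = \<epsilon> * (\<bar>t\<bar> powr p * ln (exp 1 + \<bar>t\<bar>)) + C * \<bar>t\<bar> powr p"

lemma ln_exp_1_add_ge_1: "0 \<le> t \<Longrightarrow> 1 \<le> ln (exp 1 + t)" for t :: real
  using ln_le_cancel_iff[of "exp 1" "exp 1 + t"] by (simp add: add_pos_nonneg)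

lemma exp_1_add_abs_pos: "0 < exp 1 + \<bar>t\<bar>" for t :: real
  by (simp add: add_pos_nonneg)

lemma tendsto_log_growth:
  assumes "(f \<longlongrightarrow> l) F" "0 < p"
  shows "((\<lambda>x. log_growth p \<epsilon> C (f x)) \<longlongrightarrow> log_growth p \<epsilon> C l) F"
  unfolding log_growth_def
  using assms less_imp_neq[OF exp_1_add_abs_pos[of l], symmetric]
  by (intro tendsto_intros tendsto_powr') auto

lemma borel_measurable_log_growth [measurable]:
  "log_growth p \<epsilon> C \<in> borel_measurable borel"
  unfolding log_growth_def by measurable

lemma nn_integral_log_growth:
  assumes [measurable]: "u \<in> borel_measurable M" and nn: "0 \<le> \<epsilon>" "0 \<le> C"
  shows "(\<integral>\<^sup>+x. ennreal (log_growth p \<epsilon> C (u x)) \<partial>M)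
    = ennreal \<epsilon> * (\<integral>\<^sup>+x. ennreal (\<bar>u x\<bar> powr p * ln (exp 1 + \<bar>u x\<bar>)) \<partial>M)
      + ennreal C * (\<integral>\<^sup>+x. ennreal (\<bar>u x\<bar> powr p) \<partial>M)"
proof -
  have "ennreal (log_growth p \<epsilon> C (u x))
    = ennreal \<epsilon> * ennreal (\<bar>u x\<bar> powr p * ln (exp 1 + \<bar>u x\<bar>)) + ennreal C * ennreal (\<bar>u x\<bar> powr p)" for x
    using nn ln_exp_1_add_ge_1[of "\<bar>u x\<bar>"]
    by (simp add: log_growth_def ennreal_mult'[symmetric])
  then show ?thesis by (simp add: nn_integral_add nn_integral_cmult)
qed

text \<open>Fatou's lemma and continuity of the majorant carry a bound to the limit. This serves
  twice: for the limit function itself and, with one index frozen, for its distance to the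
  sequence.\<close>

lemma nn_integral_log_growth_limit_le:
  fixes f :: "nat \<Rightarrow> 'a \<Rightarrow> real"
  assumes p: "0 < p" and [measurable]: "\<And>l. f l \<in> borel_measurable M"
    and lim: "AE x in M. (\<lambda>l. f l x) \<longlonglongrightarrow> g x"
    and le: "\<forall>\<^sub>F l in sequentially. (\<integral>\<^sup>+x. ennreal (log_growth p \<epsilon> C (f l x)) \<partial>M) \<le> Z"
  shows "(\<integral>\<^sup>+x. ennreal (log_growth p \<epsilon> C (g x)) \<partial>M) \<le> Z"
proof -
  have "(\<integral>\<^sup>+x. ennreal (log_growth p \<epsilon> C (g x)) \<partial>M)
    = (\<integral>\<^sup>+x. liminf (\<lambda>l. ennreal (log_growth p \<epsilon> C (f l x))) \<partial>M)"
  proof (rule nn_integral_cong_AE)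
    show "AE x in M. ennreal (log_growth p \<epsilon> C (g x)) = liminf (\<lambda>l. ennreal (log_growth p \<epsilon> C (f l x)))"
      using lim
    proof eventually_elim
      case (elim x)
      then have "(\<lambda>l. ennreal (log_growth p \<epsilon> C (f l x))) \<longlonglongrightarrow> ennreal (log_growth p \<epsilon> C (g x))"
        by (intro tendsto_ennrealI tendsto_log_growth p)
      then show ?case by (simp add: lim_imp_Liminf)
    qed
  qed
  also have "\<dots> \<le> liminf (\<lambda>l. \<integral>\<^sup>+x. ennreal (log_growth p \<epsilon> C (f l x)) \<partial>M)"
    by (rule nn_integral_liminf) measurable
  also have "\<dots> \<le> Z"
    using Liminf_mono[OF le] by (simp add: Liminf_const)
  finally show ?thesis .
qed

lemma log_modular_bounded:
  assumes p: "0 < p" and nn: "0 \<le> L" "0 \<le> G"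
  obtains Z :: real where "0 \<le> Z"
    "\<And>u :: real ^ 'n \<Rightarrow> real. u \<in> borel_measurable lebesgue \<Longrightarrow>
      (\<integral>\<^sup>+x. ennreal (\<bar>u x\<bar> powr p) \<partial>lebesgue) \<le> ennreal L \<Longrightarrow> log_energy p u \<le> ennreal G \<Longrightarrow>
      (\<integral>\<^sup>+x. ennreal (\<bar>u x\<bar> powr p * ln (exp 1 + \<bar>u x\<bar>)) \<partial>lebesgue) \<le> ennreal Z"
proof -
  \<comment> \<open>\<open>log_modular_le\<close> asks for a positive bound, while \<open>L\<close>
    may be 0.\<close>
  have L: "0 < L + 1" using nn by simp
  obtain a b where ab: "0 \<le> a" "0 \<le> b" and mod:
    "\<And>u :: real ^ 'n \<Rightarrow> real. u \<in> borel_measurable lebesgue \<Longrightarrow>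
      (\<integral>\<^sup>+x. ennreal (\<bar>u x\<bar> powr p) \<partial>lebesgue) \<le> ennreal (L + 1) \<Longrightarrow>
      (\<integral>\<^sup>+x. ennreal (\<bar>u x\<bar> powr p * ln (exp 1 + \<bar>u x\<bar>)) \<partial>lebesgue)
        \<le> ennreal a * (\<integral>\<^sup>+x. ennreal (\<bar>u x\<bar> powr p) \<partial>lebesgue) + ennreal b * log_energy p u"
    using log_modular_le[OF p L, where 'n = 'n] by blast
  show ?thesis
  proof (rule that[of "a * L + b * G"])
    show "0 \<le> a * L + b * G" using ab nn by simp
    fix u :: "real ^ 'n \<Rightarrow> real"
    assume u: "u \<in> borel_measurable lebesgue"
      and uL: "(\<integral>\<^sup>+x. ennreal (\<bar>u x\<bar> powr p) \<partial>lebesgue) \<le> ennreal L" and uG: "log_energy p u \<le> ennreal G"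
    have "ennreal L \<le> ennreal (L + 1)" by (rule ennreal_leI) simp
    with uL have "(\<integral>\<^sup>+x. ennreal (\<bar>u x\<bar> powr p) \<partial>lebesgue) \<le> ennreal (L + 1)" by (rule order_trans)
    from mod[OF u this]
    have "(\<integral>\<^sup>+x. ennreal (\<bar>u x\<bar> powr p * ln (exp 1 + \<bar>u x\<bar>)) \<partial>lebesgue)
      \<le> ennreal a * ennreal L + ennreal b * ennreal G"
      by (rule order_trans) (intro add_mono mult_left_mono uL uG; simp)
    also have "\<dots> = ennreal (a * L + b * G)"
      using ab nn by (simp add: ennreal_mult')
    finally show "(\<integral>\<^sup>+x. ennreal (\<bar>u x\<bar> powr p * ln (exp 1 + \<bar>u x\<bar>)) \<partial>lebesgue) \<le> ennreal (a * L + b * G)" .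
  qed
qed

text \<open>Near 0 the limit gives a multiple of \<open>t powr p\<close>, near infinity the term
  with \<open>\<epsilon>\<close> suffices, and on the bounded range between them monotonicity does
  the rest.\<close>

lemma subcritical_growth:
  fixes \<psi> :: "real \<Rightarrow> real"
  assumes p: "0 < p" and nn: "\<And>t. 0 \<le> t \<Longrightarrow> 0 \<le> \<psi> t" and \<psi>0: "\<psi> 0 = 0"
    and mono: "\<And>s t. 0 \<le> s \<Longrightarrow> s \<le> t \<Longrightarrow> \<psi> s \<le> \<psi> t"
    and lim0: "((\<lambda>t. \<psi> t / t powr p) \<longlongrightarrow> L) (at_right 0)"
    and lim: "((\<lambda>t. \<psi> t / (t powr p * ln (exp 1 + t))) \<longlongrightarrow> 0) at_top"
    and \<epsilon>: "0 < \<epsilon>"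
  obtains C where "0 \<le> C" "\<And>t. 0 \<le> t \<Longrightarrow> \<psi> t \<le> log_growth p \<epsilon> C t"
proof -
  have "\<forall>\<^sub>F t in at_right 0. \<psi> t / t powr p < L + 1"
    using lim0 by (rule order_tendstoD) simp
  then obtain d where d: "0 < d" "\<And>t. 0 < t \<Longrightarrow> t < d \<Longrightarrow> \<psi> t / t powr p < L + 1"
    unfolding eventually_at_right_field by auto
  have "\<forall>\<^sub>F t in at_top. \<psi> t / (t powr p * ln (exp 1 + t)) < \<epsilon>"
    using lim \<epsilon> by (rule order_tendstoD)
  then obtain T where T: "\<And>t. T \<le> t \<Longrightarrow> \<psi> t / (t powr p * ln (exp 1 + t)) < \<epsilon>"
    by (auto simp: eventually_at_top_linorder)
  \<comment> \<open>For \<open>d <= t <= T'\<close>, \<open>\<psi> t\<close> is at most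
    \<open>\<psi> T'\<close> and \<open>t powr p\<close> at least \<open>d powr p\<close>; this
    explains the second entry of \<open>C\<close>.\<close>
  define T' where "T' = max T d"
  define C where "C = max \<bar>L + 1\<bar> (\<psi> T' / d powr p)"
  have C: "0 \<le> C" by (auto simp: C_def)
  show ?thesis
  proof (rule that[OF C])
    fix t :: real assume t: "0 \<le> t"
    have \<phi>: "0 \<le> \<epsilon> * (t powr p * ln (exp 1 + t))"
      using \<epsilon> ln_exp_1_add_ge_1[OF t] by simp
    consider "t = 0" | "0 < t" "t < d" | "d \<le> t" "t \<le> T'" | "T' < t" using t by linarith
    then show "\<psi> t \<le> log_growth p \<epsilon> C t"
    proof cases
      case 1
      then show ?thesis using \<psi>0 by (simp add: log_growth_def)
    next
      case 2
      then have "\<psi> t \<le> (L + 1) * t powr p"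
        using d(2)[of t] by (simp add: pos_divide_less_eq less_imp_le)
      also have "\<dots> \<le> C * t powr p" by (intro mult_right_mono) (auto simp: C_def)
      finally show ?thesis using \<phi> t by (simp add: log_growth_def)
    next
      case 3
      have T'0: "0 \<le> \<psi> T'" using nn[of T'] d by (simp add: T'_def)
      have "\<psi> t \<le> \<psi> T'" using mono t 3 by simp
      also have "\<dots> = \<psi> T' / d powr p * d powr p" using d by simp
      also have "\<dots> \<le> C * t powr p"
        using 3 d p T'0 C by (intro mult_mono powr_mono2) (auto simp: C_def)
      finally show ?thesis using \<phi> t by (simp add: log_growth_def)
    next
      case 4
      then have "T \<le> t" "0 < t" using d by (auto simp: T'_def)
      then have "\<psi> t \<le> \<epsilon> * (t powr p * ln (exp 1 + t))"
        using T[of t] ln_exp_1_add_ge_1[OF t] by (simp add: pos_divide_less_eq less_imp_le)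
      also have "\<dots> \<le> log_growth p \<epsilon> C t" using C t by (simp add: log_growth_def)
      finally show ?thesis .
    qed
  qed
qed

section \<open>The compact embedding\<close>

lemma nn_integral_powr_diff_le:
  assumes [measurable]: "u \<in> borel_measurable M" "w \<in> borel_measurable M" and p: "0 < p"
  shows "(\<integral>\<^sup>+x. ennreal (\<bar>u x - w x\<bar> powr p) \<partial>M)
    \<le> ennreal (2 powr p) * ((\<integral>\<^sup>+x. ennreal (\<bar>u x\<bar> powr p) \<partial>M) + (\<integral>\<^sup>+x. ennreal (\<bar>w x\<bar> powr p) \<partial>M))"
proof -
  have "ennreal (\<bar>u x - w x\<bar> powr p) \<le> ennreal (2 powr p) * (ennreal (\<bar>u x\<bar> powr p) + ennreal (\<bar>w x\<bar> powr p))" for x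
    using ennreal_powr_add_le[OF p, of "u x" "- w x"] by simp
  then have "(\<integral>\<^sup>+x. ennreal (\<bar>u x - w x\<bar> powr p) \<partial>M)
    \<le> (\<integral>\<^sup>+x. ennreal (2 powr p) * (ennreal (\<bar>u x\<bar> powr p) + ennreal (\<bar>w x\<bar> powr p)) \<partial>M)"
    by (intro nn_integral_mono)
  also have "\<dots> = ennreal (2 powr p) * ((\<integral>\<^sup>+x. ennreal (\<bar>u x\<bar> powr p) \<partial>M) + (\<integral>\<^sup>+x. ennreal (\<bar>w x\<bar> powr p) \<partial>M))"
    by (simp add: nn_integral_cmult nn_integral_add)
  finally show ?thesis .
qed

lemma Luxemburg_norm_abs_le:
  assumes "0 < c" "Orlicz_modular \<theta> \<Omega> (\<lambda>x. u x / c) \<le> 1"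
  shows "\<bar>Luxemburg_norm \<theta> \<Omega> u\<bar> \<le> c"
proof -
  let ?S = "{c. 0 < c \<and> Orlicz_modular \<theta> \<Omega> (\<lambda>x. u x / c) \<le> 1}"
  have c: "c \<in> ?S" using assms by simp
  have "Inf ?S \<le> c" by (rule cInf_lower[OF c]) (auto intro: bdd_belowI[of _ 0])
  moreover have "0 \<le> Inf ?S" using c by (intro cInf_greatest) auto
  ultimately show ?thesis by (simp add: Luxemburg_norm_def)
qed

text \<open>Scaled differences of a bounded sequence have logarithmic modular at most some
  \<open>Z\<close>, so the term with \<open>\<epsilon>\<close> in the growth bound stays below
  \<open>\<epsilon> * Z\<close>. The term with \<open>C\<close> becomes small along an
  \<open>L^p\<close>-Cauchy subsequence.\<close>

lemma compact_embedding_of_growth: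
  fixes \<Omega> :: "(real ^ 'n) set" and \<psi> :: "real \<Rightarrow> real"
  assumes p: "1 < p" and \<Omega>: "open \<Omega>" "bounded \<Omega>"
    and growth: "\<And>\<epsilon>. 0 < \<epsilon> \<Longrightarrow> \<exists>C\<ge>0. \<forall>t\<ge>0. \<psi> t \<le> log_growth p \<epsilon> C t"
  shows "compact_embedding (X_space p \<Omega>) (X_norm p \<Omega>)
    (Orlicz_space (\<lambda>t. ennreal (\<psi> t)) \<Omega>) (Luxemburg_norm (\<lambda>t. ennreal (\<psi> t)) \<Omega>)"
proof -
  have p0: "0 < p" using p by simp
  let ?L = "Luxemburg_norm (\<lambda>t. ennreal (\<psi> t)) \<Omega>"
  obtain C\<^sub>1 where C\<^sub>1: "0 \<le> C\<^sub>1" "\<forall>t\<ge>0. \<psi> t \<le> log_growth p 1 C\<^sub>1 t"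
    using growth[OF zero_less_one] by (elim exE conjE) (rule that)
  have modular_le: "Orlicz_modular (\<lambda>t. ennreal (\<psi> t)) \<Omega> f \<le> (\<integral>\<^sup>+x. ennreal (log_growth p \<epsilon> C (f x)) \<partial>lebesgue)"
    if "\<forall>t\<ge>0. \<psi> t \<le> log_growth p \<epsilon> C t" for \<epsilon> C f
  proof -
    have "\<psi> \<bar>f x\<bar> \<le> log_growth p \<epsilon> C (f x)" for x
      using that[rule_format, of "\<bar>f x\<bar>"] by (simp add: log_growth_def)
    then have "(\<integral>\<^sup>+x. ennreal (\<psi> \<bar>f x\<bar>) \<partial>lebesgue) \<le> (\<integral>\<^sup>+x. ennreal (log_growth p \<epsilon> C (f x)) \<partial>lebesgue)"
      by (intro nn_integral_mono ennreal_leI)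
    with Orlicz_modular_le_lebesgue[OF \<Omega>(1)] show ?thesis by (rule order_trans)
  qed
  have cont: "continuous_embedding (X_space p \<Omega>) (X_norm p \<Omega>)
    (Orlicz_space (\<lambda>t. ennreal (\<psi> t)) \<Omega>) ?L"
  proof (rule continuous_embedding_of_growth[OF p \<Omega>(1)])
    show "0 \<le> 1 + C\<^sub>1" using C\<^sub>1 by simp
    fix t :: real assume t: "0 \<le> t"
    have "C\<^sub>1 * (t powr p * 1) \<le> C\<^sub>1 * (t powr p * ln (exp 1 + t))"
      using C\<^sub>1 ln_exp_1_add_ge_1[OF t] by (intro mult_left_mono) auto
    then show "\<psi> t \<le> (1 + C\<^sub>1) * (t powr p * ln (exp 1 + t))"
      using C\<^sub>1(2)[rule_format, OF t] t by (simp add: log_growth_def distrib_right)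
  qed
  have "\<exists>v\<in>Orlicz_space (\<lambda>t. ennreal (\<psi> t)) \<Omega>. \<exists>r. strict_mono r \<and> (\<lambda>k. ?L (\<lambda>x. u (r k) x - v x)) \<longlonglongrightarrow> 0"
    if u: "\<And>k. u k \<in> X_space p \<Omega>" and B: "\<And>k. X_norm p \<Omega> (u k) \<le> B" for u :: "nat \<Rightarrow> real ^ 'n \<Rightarrow> real" and B
  proof -
    define B\<^sub>1 where "B\<^sub>1 = B powr p"
    define B\<^sub>2 where "B\<^sub>2 = B powr p / C_Np CARD('n) p"
    have nn: "0 \<le> B\<^sub>1" "0 \<le> B\<^sub>2"
      using C_Np_pos[OF p0, of "CARD('n)"] by (simp_all add: B\<^sub>1_def B\<^sub>2_def)
    have um [measurable]: "u k \<in> borel_measurable lebesgue" for k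
      by (rule X_space_borel_measurable[OF u \<Omega>(1)])
    have uz: "u k x = 0" if "x \<notin> \<Omega>" for k x using u[of k] that by (auto simp: X_space_def)
    have uL: "(\<integral>\<^sup>+x. ennreal (\<bar>u k x\<bar> powr p) \<partial>lebesgue) \<le> ennreal B\<^sub>1" for k
      unfolding B\<^sub>1_def by (rule X_norm_le_imp(1)[OF u \<Omega>(1) p0 B])
    have uE: "log_energy p (u k) \<le> ennreal B\<^sub>2" for k
      unfolding B\<^sub>2_def by (rule X_norm_le_imp(2)[OF u \<Omega>(1) p0 B])
    obtain r :: "nat \<Rightarrow> nat" where r: "strict_mono r"
      and Cauchy: "\<And>e. 0 < e \<Longrightarrow> \<exists>K. \<forall>k\<ge>K. \<forall>l\<ge>K.
        (\<integral>\<^sup>+x. ennreal (\<bar>u (r k) x - u (r l) x\<bar> powr p) \<partial>lebesgue) \<le> ennreal e"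
      by (rule Lp_Cauchy_subsequence[where u = u, OF p0 \<Omega>(2) nn um]) (erule uz, rule uL, rule uE, rule that)
    obtain s :: "nat \<Rightarrow> nat" where s: "strict_mono s" and conv: "AE x in lebesgue. convergent (\<lambda>k. u (r (s k)) x)"
      by (rule Lp_Cauchy_AE_subsequence[where f = "\<lambda>k. u (r k)", OF p0 um Cauchy]) (assumption, rule that)
    define f where "f = (\<lambda>k. u (r (s k)))"
    \<comment> \<open>Where the sequence diverges, on a null set, \<open>lim\<close> has an
      unspecified value. Outside \<open>\<Omega>\<close> the sequence is constantly 0, so
      \<open>v\<close> vanishes at every such point, as \<open>Orlicz_space\<close> demands.\<close>
    define v where "v = (\<lambda>x. lim (\<lambda>k. f k x))"
    have fm [measurable]: "f k \<in> borel_measurable lebesgue" for k by (simp add: f_def)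
    have vm [measurable]: "v \<in> borel_measurable lebesgue"
      unfolding v_def by (rule borel_measurable_lim_metric) measurable
    have vz: "v x = 0" if "x \<notin> \<Omega>" for x using uz[OF that] by (simp add: v_def f_def)
    have fv: "AE x in lebesgue. (\<lambda>k. f k x) \<longlonglongrightarrow> v x"
      using conv by eventually_elim (simp add: v_def f_def convergent_LIMSEQ_iff)
    have vO: "v \<in> Orlicz_space (\<lambda>t. ennreal (\<psi> t)) \<Omega>"
    proof -
      obtain Z where Z: "0 \<le> Z" "\<And>u :: real ^ 'n \<Rightarrow> real. u \<in> borel_measurable lebesgue \<Longrightarrow>
        (\<integral>\<^sup>+x. ennreal (\<bar>u x\<bar> powr p) \<partial>lebesgue) \<le> ennreal B\<^sub>1 \<Longrightarrow> log_energy p u \<le> ennreal B\<^sub>2 \<Longrightarrow>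
        (\<integral>\<^sup>+x. ennreal (\<bar>u x\<bar> powr p * ln (exp 1 + \<bar>u x\<bar>)) \<partial>lebesgue) \<le> ennreal Z"
        by (rule log_modular_bounded[OF p0 nn, where 'n = 'n]) (rule that)
      have "(\<integral>\<^sup>+x. ennreal (log_growth p 1 C\<^sub>1 (v x)) \<partial>lebesgue) \<le> ennreal 1 * ennreal Z + ennreal C\<^sub>1 * ennreal B\<^sub>1"
      proof (rule nn_integral_log_growth_limit_le[OF p0 fm fv always_eventually], rule allI)
        fix l
        show "(\<integral>\<^sup>+x. ennreal (log_growth p 1 C\<^sub>1 (f l x)) \<partial>lebesgue) \<le> ennreal 1 * ennreal Z + ennreal C\<^sub>1 * ennreal B\<^sub>1"
          using C\<^sub>1(1) unfolding f_def
          by (subst nn_integral_log_growth) (auto intro!: add_mono mult_left_mono Z uL uE simp del: ennreal_1)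
      qed
      also have "\<dots> < \<infinity>" by (simp add: ennreal_mult_less_top)
      finally have "Orlicz_modular (\<lambda>t. ennreal (\<psi> t)) \<Omega> (\<lambda>x. 1 * v x) < \<infinity>"
        using le_less_trans[OF modular_le[OF C\<^sub>1(2)]] by simp
      moreover have "v \<in> borel_measurable (lebesgue_on \<Omega>)"
        by (rule measurable_restrict_space1[OF vm])
      ultimately show ?thesis
        unfolding Orlicz_space_def by (intro CollectI conjI exI[of _ 1] allI impI vz) auto
    qed
    \<comment> \<open>Modular at most 1 after division by \<open>c\<close> means Luxemburg norm at
      most \<open>c\<close>, so this is the convergence to be shown.\<close>
    have small: "\<exists>K. \<forall>k\<ge>K. Orlicz_modular (\<lambda>t. ennreal (\<psi> t)) \<Omega> (\<lambda>x. (f k x - v x) / c) \<le> 1" if c: "0 < c" for c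
    proof -
      define q where "q = (1 / c) powr p"
      have q: "0 < q" using c by (simp add: q_def)
      \<comment> \<open>The energy bound is available for differences of two members of the
        sequence. Letting \<open>l\<close> tend to infinity then replaces \<open>f l\<close> by
        \<open>v\<close>.\<close>
      define d where "d = (\<lambda>k l x. (1 / c) * (f k x - f l x))"
      have dm [measurable]: "d k l \<in> borel_measurable lebesgue" for k l by (simp add: d_def)
      have dL: "(\<integral>\<^sup>+x. ennreal (\<bar>d k l x\<bar> powr p) \<partial>lebesgue)
          = ennreal q * (\<integral>\<^sup>+x. ennreal (\<bar>f k x - f l x\<bar> powr p) \<partial>lebesgue)" for k l
        unfolding d_def q_def using c by (intro nn_integral_powr_cmult) auto
      have dL': "(\<integral>\<^sup>+x. ennreal (\<bar>d k l x\<bar> powr p) \<partial>lebesgue) \<le> ennreal (q * (2 powr p * (B\<^sub>1 + B\<^sub>1)))" for k l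
      proof -
        have "(\<integral>\<^sup>+x. ennreal (\<bar>d k l x\<bar> powr p) \<partial>lebesgue) \<le> ennreal q * (ennreal (2 powr p) * (ennreal B\<^sub>1 + ennreal B\<^sub>1))"
          unfolding dL f_def
          by (intro mult_left_mono order_trans[OF nn_integral_powr_diff_le[OF um um p0]] add_mono uL) auto
        also have "\<dots> = ennreal (q * (2 powr p * (B\<^sub>1 + B\<^sub>1)))"
          by (simp only: ennreal_mult' ennreal_plus powr_ge_zero nn less_imp_le[OF q])
        finally show ?thesis .
      qed
      have dE: "log_energy p (d k l) \<le> ennreal (q * (2 powr p * (B\<^sub>2 + B\<^sub>2)))" for k l
      proof -
        have "log_energy p (d k l) = ennreal q * log_energy p (\<lambda>x. f k x - f l x)"
          unfolding d_def q_def using c by (intro log_energy_cmult) auto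
        also have "\<dots> \<le> ennreal q * (ennreal (2 powr p) * (ennreal B\<^sub>2 + ennreal B\<^sub>2))"
          unfolding f_def
          by (intro mult_left_mono order_trans[OF log_energy_diff_le[OF um um p0]] add_mono uE) auto
        also have "\<dots> = ennreal (q * (2 powr p * (B\<^sub>2 + B\<^sub>2)))"
          by (simp only: ennreal_mult' ennreal_plus powr_ge_zero nn less_imp_le[OF q])
        finally show ?thesis .
      qed
      have nn': "0 \<le> q * (2 powr p * (B\<^sub>1 + B\<^sub>1))" "0 \<le> q * (2 powr p * (B\<^sub>2 + B\<^sub>2))"
        using nn q by simp_all
      obtain Z where Z: "0 \<le> Z" "\<And>u :: real ^ 'n \<Rightarrow> real. u \<in> borel_measurable lebesgue \<Longrightarrow>
        (\<integral>\<^sup>+x. ennreal (\<bar>u x\<bar> powr p) \<partial>lebesgue) \<le> ennreal (q * (2 powr p * (B\<^sub>1 + B\<^sub>1))) \<Longrightarrow>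
        log_energy p u \<le> ennreal (q * (2 powr p * (B\<^sub>2 + B\<^sub>2))) \<Longrightarrow>
        (\<integral>\<^sup>+x. ennreal (\<bar>u x\<bar> powr p * ln (exp 1 + \<bar>u x\<bar>)) \<partial>lebesgue) \<le> ennreal Z"
        by (rule log_modular_bounded[OF p0 nn', where 'n = 'n]) (rule that)
      \<comment> \<open>The order of choices matters: \<open>Z\<close> does not involve
        \<open>\<epsilon>\<close>, then \<open>C\<close> comes from the growth condition for
        \<open>\<epsilon>\<close>, and \<open>e\<close> is fixed last. Both terms of the modular are
        then at most \<open>1/2\<close>.\<close>
      define \<epsilon> where "\<epsilon> = 1 / (2 * (Z + 1))"
      have \<epsilon>: "0 < \<epsilon>" "\<epsilon> * Z \<le> 1 / 2" using Z(1) by (simp_all add: \<epsilon>_def field_simps)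
      obtain C where C: "0 \<le> C" "\<forall>t\<ge>0. \<psi> t \<le> log_growth p \<epsilon> C t"
        using growth[OF \<epsilon>(1)] by (elim exE conjE) (rule that)
      define e where "e = 1 / (2 * q * (C + 1))"
      have e: "0 < e" unfolding e_def using q C(1) by (intro divide_pos_pos mult_pos_pos) auto
      have "q * e = 1 / (2 * (C + 1))" using q by (simp add: e_def)
      then have Cqe: "C * (q * e) \<le> 1 / 2" using C(1) by (simp add: pos_divide_le_eq)
      obtain K where K: "\<forall>k\<ge>K. \<forall>l\<ge>K. (\<integral>\<^sup>+x. ennreal (\<bar>u (r k) x - u (r l) x\<bar> powr p) \<partial>lebesgue) \<le> ennreal e"
        using Cauchy[OF e] by (elim exE) (rule that)
      have dH: "(\<integral>\<^sup>+x. ennreal (log_growth p \<epsilon> C (d k l x)) \<partial>lebesgue) \<le> 1" if "K \<le> k" "K \<le> l" for k l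
      proof -
        have "K \<le> s k" "K \<le> s l" using that seq_suble[OF s] order_trans by blast+
        then have "(\<integral>\<^sup>+x. ennreal (\<bar>d k l x\<bar> powr p) \<partial>lebesgue) \<le> ennreal q * ennreal e"
          unfolding dL f_def using K by (intro mult_left_mono) auto
        then have "(\<integral>\<^sup>+x. ennreal (log_growth p \<epsilon> C (d k l x)) \<partial>lebesgue)
          \<le> ennreal \<epsilon> * ennreal Z + ennreal C * (ennreal q * ennreal e)"
          using \<epsilon>(1) C(1)
          by (subst nn_integral_log_growth) (auto intro!: add_mono mult_left_mono Z(2) dL' dE)
        also have "\<dots> = ennreal (\<epsilon> * Z + C * (q * e))"
          using \<epsilon>(1) Z(1) C(1) q e by (simp add: ennreal_mult')
        also have "\<dots> \<le> ennreal 1"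
          using \<epsilon>(2) Cqe by (intro ennreal_leI) linarith
        finally show ?thesis by simp
      qed
      show ?thesis
      proof (intro exI[of _ K] allI impI)
        fix k assume k: "K \<le> k"
        have "(\<integral>\<^sup>+x. ennreal (log_growth p \<epsilon> C ((f k x - v x) / c)) \<partial>lebesgue) \<le> 1"
        proof (rule nn_integral_log_growth_limit_le[OF p0 dm])
          show "AE x in lebesgue. (\<lambda>l. d k l x) \<longlonglongrightarrow> (f k x - v x) / c"
            using fv
          proof eventually_elim
            case (elim x)
            then have "(\<lambda>l. (1 / c) * (f k x - f l x)) \<longlonglongrightarrow> (1 / c) * (f k x - v x)"
              by (intro tendsto_intros)
            then show ?case by (simp add: d_def)
          qed
          show "\<forall>\<^sub>F l in sequentially. (\<integral>\<^sup>+x. ennreal (log_growth p \<epsilon> C (d k l x)) \<partial>lebesgue) \<le> 1"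
            using dH[OF k] by (auto simp: eventually_sequentially)
        qed
        with modular_le[OF C(2)] show "Orlicz_modular (\<lambda>t. ennreal (\<psi> t)) \<Omega> (\<lambda>x. (f k x - v x) / c) \<le> 1"
          by (rule order_trans)
      qed
    qed
    have "(\<lambda>k. ?L (\<lambda>x. f k x - v x)) \<longlonglongrightarrow> 0"
    proof (rule LIMSEQ_I)
      fix e :: real assume e: "0 < e"
      \<comment> \<open>The divisor \<open>e / 2\<close> yields the strict inequality in the
        definition of the limit.\<close>
      obtain K where K: "\<forall>k\<ge>K. Orlicz_modular (\<lambda>t. ennreal (\<psi> t)) \<Omega> (\<lambda>x. (f k x - v x) / (e / 2)) \<le> 1"
        using small[OF half_gt_zero[OF e]] by (elim exE) (rule that)
      have "\<bar>?L (\<lambda>x. f k x - v x)\<bar> \<le> e / 2" if "K \<le> k" for k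
        using e K[rule_format, OF that] by (intro Luxemburg_norm_abs_le) simp_all
      then show "\<exists>K. \<forall>k\<ge>K. norm (?L (\<lambda>x. f k x - v x) - 0) < e"
        using e by (intro exI[of _ K]) force
    qed
    then show ?thesis
      using vO strict_mono_compose[OF r s] unfolding f_def
      by (intro bexI[of _ v] exI[of _ "\<lambda>k. r (s k)"] conjI) auto
  qed
  note subseq = this
  show ?thesis
    unfolding compact_embedding_def
    by (intro conjI cont allI impI, elim conjE exE) (rule subseq, erule spec, erule spec)
qed

theorem theorem2p8:
  fixes p :: real and \<Omega> :: "(real ^ 'n) set" and \<phi> \<psi> :: "real \<Rightarrow> real"
  assumes "1 < p"
    and "bounded_domain \<Omega>"
    and "\<And>t. 0 \<le> t \<Longrightarrow> 0 \<le> \<phi> t"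
    and "\<And>t. 0 \<le> t \<Longrightarrow> 0 \<le> \<psi> t"
    and "convex_Phi_function (\<lambda>t. ennreal (\<phi> t))"
    and "convex_Phi_function (\<lambda>t. ennreal (\<psi> t))"
    and "\<And>t. 0 \<le> t \<Longrightarrow> \<phi> t = t powr p * ln (exp 1 + t)"
    and "\<exists>L::real. ((\<lambda>t. \<psi> t / t powr p) \<longlongrightarrow> L) (at_right 0)"
    and "((\<lambda>t. \<psi> t / \<phi> t) \<longlongrightarrow> 0) at_top"
  shows "continuous_embedding (X_space p \<Omega>) (X_norm p \<Omega>)
           (Orlicz_space (\<lambda>t. ennreal (\<phi> t)) \<Omega>) (Luxemburg_norm (\<lambda>t. ennreal (\<phi> t)) \<Omega>)
       \<and> compact_embedding (X_space p \<Omega>) (X_norm p \<Omega>)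
           (Orlicz_space (\<lambda>t. ennreal (\<psi> t)) \<Omega>) (Luxemburg_norm (\<lambda>t. ennreal (\<psi> t)) \<Omega>)"
proof
  have \<Omega>: "open \<Omega>" "bounded \<Omega>" using assms(2) by (auto simp: bounded_domain_def)
  show "continuous_embedding (X_space p \<Omega>) (X_norm p \<Omega>)
           (Orlicz_space (\<lambda>t. ennreal (\<phi> t)) \<Omega>) (Luxemburg_norm (\<lambda>t. ennreal (\<phi> t)) \<Omega>)"
    using assms(7) by (intro continuous_embedding_of_growth[OF assms(1) \<Omega>(1), of 1]) auto
  show "compact_embedding (X_space p \<Omega>) (X_norm p \<Omega>)
           (Orlicz_space (\<lambda>t. ennreal (\<psi> t)) \<Omega>) (Luxemburg_norm (\<lambda>t. ennreal (\<psi> t)) \<Omega>)"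
  proof (rule compact_embedding_of_growth[OF assms(1) \<Omega>])
    fix \<epsilon> :: real assume \<epsilon>: "0 < \<epsilon>"
    obtain L where L: "((\<lambda>t. \<psi> t / t powr p) \<longlongrightarrow> L) (at_right 0)" using assms(8) by blast
    \<comment> \<open>Being nonnegative, \<open>\<psi>\<close> inherits monotonicity and its zero at
      0 from the \<open>ennreal\<close> version.\<close>
    have Phi: "mono_on {0..} (\<lambda>t. ennreal (\<psi> t))" "ennreal (\<psi> 0) = 0"
      using assms(6) by (auto simp: convex_Phi_function_def Phi_function_def)
    have \<psi>0: "\<psi> 0 = 0" using Phi(2) assms(4)[of 0] by (simp add: ennreal_eq_0_iff)
    have mono: "\<psi> s \<le> \<psi> t" if "0 \<le> s" "s \<le> t" for s t
      using mono_onD[OF Phi(1), of s t] that assms(4)[of t] by simp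
    have "\<forall>\<^sub>F t in at_top. \<psi> t / \<phi> t = \<psi> t / (t powr p * ln (exp 1 + t))"
      using eventually_ge_at_top[of 0] by eventually_elim (simp add: assms(7))
    with assms(9) have lim: "((\<lambda>t. \<psi> t / (t powr p * ln (exp 1 + t))) \<longlongrightarrow> 0) at_top"
      by (rule Lim_transform_eventually)
    have "0 < p" using assms(1) by simp
    from subcritical_growth[OF this assms(4) \<psi>0 mono L lim \<epsilon>]
    show "\<exists>C\<ge>0. \<forall>t\<ge>0. \<psi> t \<le> log_growth p \<epsilon> C t" by blast
  qed
qed

end
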